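(* Let $\Gamma=(V,E)$ be a finite connected simple undirected graph, let $B\subsetneq V$ be a set of at least $2$ vertices, no two of which are adjacent, and let $u:B\to\mathbb{R}$ be injective. Let $\widehat{\Gamma}$ be the graph obtained from $\Gamma$ by adding an edge between each pair of elements of $B$. The Dirichlet arrangement $\mathcal{A}_{\Gamma,u}$ is supersolvable if and only if the graph $\widehat{\Gamma}$ is chordal.
   Context: The graphic arrangement $\mathcal{A}_\Gamma$ is the set of hyperplanes $\{x_i=x_j\}$ in $\mathbb{R}^V$, one for each edge $ij\in E$. Let $X=\{x\in\mathbb{R}^V: x_j=u(j)\text{ for all }j\in B\}$, an affine space with coordinates $x_i$, $i\in V\setminus B$. The Dirichlet arrangement $\mathcal{A}_{\Gamma,u}$ is the arrangement in $X$ of the hyperplanes $H\cap X$ for $H\in\mathcal{A}_\Gamma$. It is non-central (its hyperplanes have empty common intersection). For an arrangement $\mathcal{A}$ in $\mathbb{R}^n$ with affine defining functions $f_H$ ($H\in\mathcal{A}$), the cone $c\mathcal{A}$ is the central arrangement in $\mathbb{R}^{n+1}$ consisting of the hyperplane $\{x_0=0\}$ and the zero sets of the homogenizations of the $f_H$ with respect to the new variable $x_0$. The intersection poset $L(\mathcal{A})$ is the set of nonempty intersections of elements of $\mathcal{A}$ (including the whole space), ordered by reverse inclusion and ranked by codimension; for a central arrangement it is a geometric lattice. An element $Y$ of such a lattice $L$ is modular if $\mathrm{rk}(Y)+\mathrm{rk}(Z)=\mathrm{rk}(Y\wedge Z)+\mathrm{rk}(Y\vee Z)$ for all $Z\in L$.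 A non-central arrangement $\mathcal{A}$ is supersolvable if there is a maximal chain of $L(c\mathcal{A})$ consisting entirely of modular elements. A graph is chordal if it has a perfect elimination ordering, i.e. an ordering $i_1,\dots,i_N$ of its vertices such that for each $s$ the neighbors of $i_s$ in the subgraph induced by $\{i_s,\dots,i_N\}$ are pairwise adjacent. *)

theory Defs
  imports "HOL-Analysis.Analysis" "HOL-Algebra.Lattice"
begin

subsection \<open>Graphs\<close>

text \<open>The vertex set of a finite graph is a type \<open>'v\<close> of class \<open>finite\<close>, and a simple
  undirected graph on it is its set of edges, each a two-element set of vertices.\<close>

definition simple_graph :: "'v set set \<Rightarrow> bool" where
  "simple_graph E \<longleftrightarrow> (\<forall>e\<in>E. card e = 2)"

definition graph_connected :: "'v set set \<Rightarrow> bool" where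
  "graph_connected E \<longleftrightarrow> (\<forall>i j. (i, j) \<in> {(x, y). {x, y} \<in> E}\<^sup>*)"

definition perfect_elimination_ordering :: "'v set set \<Rightarrow> 'v list \<Rightarrow> bool" where
  "perfect_elimination_ordering E vs \<longleftrightarrow>
     distinct vs \<and> set vs = UNIV \<and>
     (\<forall>s < length vs. pairwise (\<lambda>x y. {x, y} \<in> E) {w \<in> set (drop s vs). {vs ! s, w} \<in> E})"

definition chordal :: "'v set set \<Rightarrow> bool" where
  "chordal E \<longleftrightarrow> (\<exists>vs. perfect_elimination_ordering E vs)"

definition add_clique :: "'v set set \<Rightarrow> 'v set \<Rightarrow> 'v set set" where
  "add_clique E B = E \<union> {{i, j} | i j. i \<in> B \<and> j \<in> B \<and> i \<noteq> j}"


subsection \<open>Graphic and Dirichlet arrangements\<close>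

definition graphic_arrangement :: "'v::finite set set \<Rightarrow> (real ^ 'v) set set" where
  "graphic_arrangement E = {{x. x $ i = x $ j} | i j. {i, j} \<in> E}"

definition dirichlet_space :: "'v::finite set \<Rightarrow> ('v \<Rightarrow> real) \<Rightarrow> (real ^ 'v) set" where
  "dirichlet_space B u = {x. \<forall>j\<in>B. x $ j = u j}"

definition dirichlet_arrangement ::
    "'v::finite set set \<Rightarrow> 'v set \<Rightarrow> ('v \<Rightarrow> real) \<Rightarrow> (real ^ 'v) set set" where
  "dirichlet_arrangement E B u = (\<lambda>H. H \<inter> dirichlet_space B u) ` graphic_arrangement E"


subsection \<open>The cone of an arrangement\<close>

text \<open>Let \<open>X\<close> be an affine subspace of \<open>real ^ 'v\<close> on which the \<open>x $ i\<close> with \<open>i \<in> I\<close> form a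
  coordinate system, so that \<open>X\<close> plays the role of \<open>\<real>\<^sup>n\<close> with \<open>n = card I\<close>.  The space
  \<open>\<real>\<^sup>n\<^sup>+\<^sup>1\<close> of the cone, with coordinates \<open>x\<^sub>0\<close> and \<open>x\<^sub>i\<close> for \<open>i \<in> I\<close>, is modelled as the
  linear subspace of \<open>real \<times> (real ^ 'v)\<close> in which the coordinates outside \<open>I\<close> vanish.\<close>

definition cone_space :: "'v::finite set \<Rightarrow> (real \<times> (real ^ 'v)) set" where
  "cone_space I = {(x0, x). \<forall>j. j \<notin> I \<longrightarrow> x $ j = 0}"

definition aff_fun :: "'v::finite set \<Rightarrow> real \<Rightarrow> ('v \<Rightarrow> real) \<Rightarrow> (real ^ 'v) \<Rightarrow> real" where
  "aff_fun I c a x = c + (\<Sum>i\<in>I. a i * x $ i)"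

definition homogenization ::
    "'v::finite set \<Rightarrow> real \<Rightarrow> ('v \<Rightarrow> real) \<Rightarrow> real \<times> (real ^ 'v) \<Rightarrow> real" where
  "homogenization I c a = (\<lambda>(x0, x). c * x0 + (\<Sum>i\<in>I. a i * x $ i))"

text \<open>A nonconstant affine function on \<open>X\<close> is determined by its zero set up to a nonzero
  factor, so each hyperplane of \<open>A\<close> contributes exactly one hyperplane to the cone,
  whichever of its defining functions is taken.\<close>

definition cone_arrangement ::
    "'v::finite set \<Rightarrow> (real ^ 'v) set \<Rightarrow> (real ^ 'v) set set \<Rightarrow> (real \<times> (real ^ 'v)) set set" where
  "cone_arrangement I X A =
     insert {p \<in> cone_space I. fst p = 0}
       {{p \<in> cone_space I. homogenization I c a p = 0} | c a.
          (\<exists>i\<in>I. a i \<noteq> 0) \<and> {x \<in> X. aff_fun I c a x = 0} \<in> A}"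


subsection \<open>Intersection posets and supersolvability\<close>

text \<open>\<open>W\<close> is the space in which the arrangement \<open>A\<close> lives; it is the empty intersection.\<close>

definition intersection_poset :: "'e set \<Rightarrow> 'e set set \<Rightarrow> 'e set gorder" where
  "intersection_poset W A =
     \<lparr>carrier = {W \<inter> \<Inter>S | S. S \<subseteq> A \<and> W \<inter> \<Inter>S \<noteq> {}},
      eq = (=),
      le = (\<lambda>Y Z. Z \<subseteq> Y)\<rparr>"

definition codim :: "'e::euclidean_space set \<Rightarrow> 'e set \<Rightarrow> int" where
  "codim W Y = aff_dim W - aff_dim Y"

definition modular_element :: "'l gorder \<Rightarrow> ('l \<Rightarrow> int) \<Rightarrow> 'l \<Rightarrow> bool" where
  "modular_element L rk Y \<longleftrightarrow>
     Y \<in> carrier L \<and>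
     (\<forall>Z\<in>carrier L. rk Y + rk Z = rk (Y \<sqinter>\<^bsub>L\<^esub> Z) + rk (Y \<squnion>\<^bsub>L\<^esub> Z))"

text \<open>Supersolvability of a non-central arrangement \<open>A\<close> in \<open>X\<close>, with \<open>I\<close> as above.\<close>

definition supersolvable ::
    "'v::finite set \<Rightarrow> (real ^ 'v) set \<Rightarrow> (real ^ 'v) set set \<Rightarrow> bool" where
  "supersolvable I X A \<longleftrightarrow>
     (let W = cone_space I; L = intersection_poset W (cone_arrangement I X A)
      in \<exists>C. pred_on.maxchain (carrier L) (lless L) C \<and>
             (\<forall>Y\<in>C. modular_element L (codim W) Y))"

lemma dirichlet_arrangement_noncentral:
  assumes "graph_connected E" "card B \<ge> 2" "inj_on u B"
  shows "dirichlet_space B u \<inter> \<Inter>(dirichlet_arrangement E B u) = {}"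
proof (rule ccontr)
  assume "\<not> ?thesis"
  then obtain x where x: "x \<in> dirichlet_space B u" "x \<in> \<Inter>(dirichlet_arrangement E B u)"
    by blast
  have edge: "x $ i = x $ j" if "{i, j} \<in> E" for i j
  proof -
    have "{y. y $ i = y $ j} \<inter> dirichlet_space B u \<in> dirichlet_arrangement E B u"
      using that unfolding dirichlet_arrangement_def graphic_arrangement_def by blast
    then show ?thesis
      using x(2) by blast
  qed
  have const: "x $ i = x $ j" for i j
  proof -
    have "(i, j) \<in> {(x, y). {x, y} \<in> E}\<^sup>*"
      using assms(1) by (simp add: graph_connected_def)
    then show ?thesis
    proof (induction rule: rtrancl_induct)
      case (step y z)
      then show ?case using edge[of y z] by simp
    qed simp
  qed
  obtain i j where "i \<in> B" "j \<in> B" "i \<noteq> j"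
    using assms(2) card_le_Suc0_iff_eq[OF finite, of B] by fastforce
  moreover from this have "u i = u j"
    using x(1) const[of i j] by (simp add: dirichlet_space_def)
  ultimately show False
    using assms(3) by (auto dest: inj_onD)
qed

end

theory Submission
  imports Defs
begin

text \<open>In the lattice of flats of a central arrangement, \<open>Y\<close> is modular iff \<open>Y + Z\<close> is again a flat for
  every flat \<open>Z\<close>.  Put \<open>\<phi> v = x\<^sub>v\<close> for interior \<open>v\<close> and \<open>\<phi> b = u b * x\<^sub>0\<close> for \<open>b \<in> B\<close>.  The hyperplanes of
  the cone are then \<open>\<phi> v = \<phi> w\<close> for the edges \<open>vw\<close> of the completed graph.

  If that graph is chordal, it has no hole (induced cycle of length at least 4), so by
  Dirac's theorem it has a perfect elimination ordering in which the clique \<open>B\<close> comes last.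
  For a final segment \<open>T\<close> of the interior vertices let \<open>Y\<^sub>T\<close> be given by \<open>x\<^sub>0 = 0\<close> and \<open>x\<^sub>i = 0\<close> for
  \<open>i \<in> T\<close>.  Adding \<open>Y\<^sub>T\<close> to a flat eliminates the coordinates outside \<open>T\<close>; eliminating a simplicial
  vertex only produces equations along edges among its neighbours.  So these flats are
  modular, and together with the whole space they form a maximal chain.

  Conversely, let the graph have a hole.  Along a maximal chain of modular flats, consider
  the smallest \<open>Y\<close> that violates some equation of the hole.  It violates at least two, as the
  equations of a cycle are dependent, and for any two violated ones modularity gives a third
  hyperplane that contains \<open>Y\<close> and depends on them.  That is a chord of the hole, except when
  one of the two equations is \<open>x\<^sub>0 = 0\<close>, where it allows to swap a boundary vertex of the cycle
  for another one, and then the cycle forces \<open>x\<^sub>0 = 0\<close> on \<open>Y\<close>.\<close>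

subsection \<open>Graphs without holes\<close>

text \<open>The single equivalence demands the cycle edges and excludes chords and loops at once; a
  pair may be met in either direction around the cycle.\<close>

definition hole :: "('a \<Rightarrow> 'a \<Rightarrow> bool) \<Rightarrow> 'a list \<Rightarrow> bool" where
  "hole adj cs \<longleftrightarrow> distinct cs \<and> 4 \<le> length cs \<and>
     (\<forall>i<length cs. \<forall>j<length cs. adj (cs ! i) (cs ! j) \<longleftrightarrow>
        j = Suc i mod length cs \<or> i = Suc j mod length cs)"

text \<open>A perfect elimination ordering of \<open>set vs \<union> K\<close> whose final part
  \<open>K\<close> stays unordered and unlisted, but still counts when neighbours are
  collected.\<close>

fun elimination_list :: "('a \<Rightarrow> 'a \<Rightarrow> bool) \<Rightarrow> 'a set \<Rightarrow> 'a list \<Rightarrow> bool" where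
  "elimination_list adj K [] \<longleftrightarrow> True"
| "elimination_list adj K (v # vs) \<longleftrightarrow>
     v \<notin> set vs \<union> K \<and> pairwise adj {w \<in> set vs \<union> K. adj v w} \<and> elimination_list adj K vs"

text \<open>A repeated vertex or a chord between positions \<open>i\<close> and \<open>j\<close>
  would allow the segment between them to be cut out, leaving a shorter walk on the same
  vertices.\<close>

lemma shortest_walk_chordless:
  assumes walk: "ps \<noteq> []" "successively adj ps"
    and shortest: "\<And>qs. \<lbrakk>qs \<noteq> []; successively adj qs; hd qs = hd ps; last qs = last ps;
      set qs \<subseteq> set ps\<rbrakk> \<Longrightarrow> length ps \<le> length qs"
    and ij: "i < j" "j < length ps"
  shows "ps ! i \<noteq> ps ! j" and "adj (ps ! i) (ps ! j) \<Longrightarrow> j = Suc i"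
proof -
  have succ: "adj (ps ! k) (ps ! Suc k)" if "Suc k < length ps" for k
    using walk(2) that by (simp add: successively_conv_nth)
  have sub: "set (take k ps @ drop l ps) \<subseteq> set ps" for k l
    using set_take_subset[of k ps] set_drop_subset[of l ps] by auto
  have sw: "successively adj (take k ps)" "successively adj (drop k ps)" for k
    using walk(2) successively_append_iff[of adj "take k ps" "drop k ps"] by simp_all
  show "ps ! i \<noteq> ps ! j"
  proof
    assume eq: "ps ! i = ps ! j"
    let ?qs = "take i ps @ drop j ps"
    have "successively adj ?qs"
    \<comment> \<open>For \<open>i = 0\<close> the prefix is empty; otherwise its last vertex is
      followed on the walk by \<open>ps ! i\<close>, which equals \<open>ps ! j\<close>.\<close>
    proof (cases i)
      case (Suc k)
      then have "adj (last (take i ps)) (hd (drop j ps))"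
        using succ[of k] ij eq by (simp add: take_Suc_conv_app_nth hd_drop_conv_nth)
      then show ?thesis using sw by (simp add: successively_append_iff)
    qed (use sw in simp)
    moreover have "hd ?qs = hd ps"
      using ij eq walk(1) by (cases "i = 0") (auto simp: hd_append hd_drop_conv_nth hd_conv_nth)
    moreover have "last ?qs = last ps" "?qs \<noteq> []" using ij by auto
    ultimately have "length ps \<le> length ?qs" using shortest sub by blast
    then show False using ij by simp
  qed
  show "j = Suc i" if a: "adj (ps ! i) (ps ! j)"
  proof (rule ccontr)
    assume "j \<noteq> Suc i"
    let ?qs = "take (Suc i) ps @ drop j ps"
    have "adj (last (take (Suc i) ps)) (hd (drop j ps))"
      using ij a by (simp add: take_Suc_conv_app_nth hd_drop_conv_nth)
    then have "successively adj ?qs" using sw by (simp add: successively_append_iff)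
    moreover have "hd ?qs = hd ps" "last ?qs = last ps" "?qs \<noteq> []"
      using ij walk(1) by (auto simp: hd_append)
    ultimately have "length ps \<le> length ?qs" using shortest sub by blast
    then show False using ij \<open>j \<noteq> Suc i\<close> by simp
  qed
qed

text \<open>A shortest walk from \<open>x\<close> to \<open>y\<close> through \<open>C\<close> is an
  induced path on at least three vertices, and \<open>v\<close> is adjacent to its two ends only, so
  \<open>v\<close> closes it to an induced cycle.\<close>

lemma hole_if_walk_avoiding_neighbours:
  assumes sym: "symp adj" and irrefl: "irreflp adj"
    and v: "adj v x" "adj v y" and xy: "x \<noteq> y" "\<not> adj x y"
    and C: "\<And>c. c \<in> C \<Longrightarrow> c \<noteq> v \<and> \<not> adj v c"
    and ps: "ps \<noteq> []" "successively adj ps" "hd ps = x" "last ps = y"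
      "set ps \<subseteq> insert x (insert y C)"
  shows "\<exists>cs. hole adj cs"
proof -
  let ?P = "\<lambda>ps. ps \<noteq> [] \<and> successively adj ps \<and> hd ps = x \<and> last ps = y \<and>
    set ps \<subseteq> insert x (insert y C)"
  obtain qs where qs: "?P qs" and min: "\<And>rs. ?P rs \<Longrightarrow> length qs \<le> length rs"
    using ex_has_least_nat[of ?P ps length] ps by blast
  let ?n = "length qs"
  have ch: "qs ! i \<noteq> qs ! j" "adj (qs ! i) (qs ! j) \<Longrightarrow> j = Suc i" if "i < j" "j < ?n" for i j
    using shortest_walk_chordless[of qs adj i j] qs min that by (metis order_trans)+
  have dist: "distinct qs"
    unfolding distinct_conv_nth using ch(1) by (metis linorder_neq_iff)
  have x0: "qs ! 0 = x" and yl: "qs ! (?n - 1) = y"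
    using qs by (auto simp: hd_conv_nth last_conv_nth)
  have n3: "3 \<le> ?n"
  proof (rule ccontr)
    assume "\<not> 3 \<le> ?n"
    moreover have "?n \<noteq> 0" using qs by simp
    ultimately have "?n = 1 \<or> ?n = 2" by linarith
    then show False
      using x0 yl xy qs by (auto simp: successively_conv_nth)
  qed
  have vin: "adj v (qs ! i) \<longleftrightarrow> i = 0 \<or> i = ?n - 1" if "i < ?n" for i
  proof -
    have "qs ! i \<in> C" if "i \<noteq> 0" "i \<noteq> ?n - 1"
    proof -
      have "qs ! i \<noteq> x" "qs ! i \<noteq> y"
        using ch(1)[of 0 i] ch(1)[of i "?n - 1"] x0 yl \<open>i < ?n\<close> that n3 by fastforce+
      then show ?thesis using qs \<open>i < ?n\<close> nth_mem by fastforce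
    qed
    then show ?thesis using C v x0 yl by blast
  qed
  have vnot: "v \<notin> set qs"
    using qs C v irreflpD[OF irrefl, of v] by auto
  have succ: "adj (qs ! k) (qs ! Suc k)" if "Suc k < ?n" for k
    using qs that by (simp add: successively_conv_nth)
  have up: "adj (qs ! i) (qs ! j) \<longleftrightarrow> j = Suc i" if "i < j" "j < ?n" for i j
    using ch that succ by blast
  have main: "adj ((v # qs) ! i) ((v # qs) ! j) \<longleftrightarrow>
      j = Suc i mod Suc ?n \<or> i = Suc j mod Suc ?n" if ij: "i < j" "j < Suc ?n" for i j
  proof -
    obtain l where l: "j = Suc l" "l < ?n" using ij by (cases j) auto
    have mods: "Suc i mod Suc ?n = Suc i" "Suc j mod Suc ?n = (if j = ?n then 0 else Suc j)"
      using ij by auto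
    show ?thesis
    proof (cases i)
      case 0
      then show ?thesis unfolding mods using l vin[OF l(2)] n3 by auto
    next
      case (Suc k)
      then show ?thesis unfolding mods using l ij up[of k l] by auto
    qed
  qed
  have "hole adj (v # qs)"
    unfolding hole_def
  proof (intro conjI allI impI)
    fix i j assume ij: "i < length (v # qs)" "j < length (v # qs)"
    have "i < j \<or> i = j \<or> j < i" by linarith
    then show "adj ((v # qs) ! i) ((v # qs) ! j) \<longleftrightarrow>
        j = Suc i mod length (v # qs) \<or> i = Suc j mod length (v # qs)"
    proof (elim disjE)
      assume "i = j"
      moreover have "i \<noteq> Suc i mod Suc ?n" using n3 ij by (cases "i = ?n") auto
      ultimately show ?thesis using irrefl by (auto dest: irreflpD)
    next
      assume "i < j" then show ?thesis using main[of i j] ij by simp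
    next
      assume "j < i" then show ?thesis using main[of j i] ij sympD[OF sym]
        by (auto simp del: nth_Cons_Suc)
    qed
  qed (use dist vnot n3 in auto)
  then show ?thesis by blast
qed

text \<open>Dirac's theorem.  Take a non-universal vertex \<open>v\<close> whose closed neighbourhood contains \<open>K\<close>, a
  component \<open>C\<close> of the graph outside that neighbourhood, and the set \<open>S\<close> of vertices attached
  to \<open>C\<close>.  As there is no hole, \<open>S\<close> is a clique, and induction applies to \<open>C \<union> S\<close> and \<open>S\<close>.\<close>
lemma simplicial_vertex_outside_clique:
  assumes sym: "symp adj" and irrefl: "irreflp adj" and nohole: "\<nexists>cs. hole adj cs"
    and "finite U" "K \<subset> U" "pairwise adj K"
  shows "\<exists>w\<in>U - K. pairwise adj {z \<in> U. adj w z}"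
  using assms(4-)
proof (induction U arbitrary: K rule: finite_psubset_induct)
  case (psubset U)
  show ?case
  proof (cases "pairwise adj U")
    case True
    then show ?thesis using psubset.prems(1)
      by (auto intro: pairwise_subset)
  next
    case False
    \<comment> \<open>If some vertex of the clique \<open>K\<close> is not universal, it serves as
      \<open>v\<close>. Otherwise every vertex is adjacent to all of \<open>K\<close>, and any
      non-universal vertex will do.\<close>
    obtain v where v: "v \<in> U" "\<exists>w\<in>U. w \<noteq> v \<and> \<not> adj v w" "\<And>k. k \<in> K \<Longrightarrow> k = v \<or> adj v k"
    proof (cases "\<exists>k\<in>K. \<exists>w\<in>U. w \<noteq> k \<and> \<not> adj k w")
      case True
      then obtain k where k: "k \<in> K" "\<exists>w\<in>U. w \<noteq> k \<and> \<not> adj k w" by blast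
      have "k \<in> U" using k(1) psubset.prems(1) by (rule psubsetD[rotated])
      moreover have "l = k \<or> adj k l" if "l \<in> K" for l
        using pairwiseD[OF psubset.prems(2) k(1) that] by metis
      ultimately show ?thesis using that[of k] k(2) by simp
    next
      case K: False
      obtain v w where "v \<in> U" "w \<in> U" "v \<noteq> w" "\<not> adj v w"
        using False by (auto simp: pairwise_def)
      then show ?thesis using that[of v] K sympD[OF sym] by metis
    qed
    define R where "R = {w \<in> U. w \<noteq> v \<and> \<not> adj v w}"
    obtain c0 where c0: "c0 \<in> R" using v(2) unfolding R_def by blast
    define r where "r a b \<longleftrightarrow> a \<in> R \<and> b \<in> R \<and> adj a b" for a b
    define C where "C = {w. r\<^sup>*\<^sup>* c0 w}"
    have symr: "symp r\<^sup>*\<^sup>*"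
      using sym by (intro symp_rtranclp) (auto simp: r_def symp_def)
    have CR: "C \<subseteq> R"
    proof
      fix w assume "w \<in> C"
      then have "r\<^sup>*\<^sup>* c0 w" by (simp add: C_def)
      then show "w \<in> R" by (cases rule: rtranclp.cases) (auto simp: r_def c0)
    qed
    define S where "S = {s \<in> U - C. \<exists>c\<in>C. adj s c}"
    have closed: "w \<in> C" if "c \<in> C" "adj c w" "w \<in> R" for c w
      using that CR unfolding C_def r_def by (auto intro: rtranclp.rtrancl_into_rtrancl)
    have SN: "adj v s" if s: "s \<in> S" for s
    proof -
      obtain c where c: "s \<in> U" "s \<notin> C" "c \<in> C" "adj s c" using s by (auto simp: S_def)
      then have "s \<notin> R" using closed sympD[OF sym] by blast
      then show ?thesis using c CR by (auto simp: R_def)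
    qed
    have walk: "\<exists>ps. ps \<noteq> [] \<and> successively adj ps \<and> hd ps = a \<and> last ps = b \<and> set ps \<subseteq> C"
      if "a \<in> C" "b \<in> C" for a b
    proof -
      have "r\<^sup>*\<^sup>* a b"
        using that sympD[OF symr] unfolding C_def by (metis mem_Collect_eq rtranclp_trans)
      then show ?thesis
      proof (induction rule: rtranclp_induct)
        case base then show ?case using \<open>a \<in> C\<close> by (intro exI[of _ "[a]"]) auto
      next
        case (step y z)
        then obtain ps where ps: "ps \<noteq> []" "successively adj ps" "hd ps = a" "last ps = y"
          "set ps \<subseteq> C" by blast
        then have "y \<in> C" by (metis last_in_set subsetD)
        then have "z \<in> C" using step closed by (auto simp: r_def)
        then show ?case using ps step
          by (intro exI[of _ "ps @ [z]"]) (auto simp: successively_append_iff r_def)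
      qed
    qed
    \<comment> \<open>Nonadjacent \<open>x\<close> and \<open>y\<close> in \<open>S\<close> would be
      joined by a walk through \<open>C\<close>, which avoids \<open>v\<close> and its neighbours,
      and a hole through \<open>v\<close> would result.\<close>
    have "pairwise adj S"
    proof (rule pairwiseI)
      fix x y assume S: "x \<in> S" "y \<in> S" "x \<noteq> y"
      obtain a b where ab: "a \<in> C" "adj x a" "b \<in> C" "adj y b" using S by (auto simp: S_def)
      obtain ps where ps: "ps \<noteq> []" "successively adj ps" "hd ps = a" "last ps = b" "set ps \<subseteq> C"
        using walk ab by blast
      have "successively adj (x # ps @ [y])"
        using ps ab sympD[OF sym] by (auto simp: successively_append_iff successively_Cons)
      then show "adj x y"
        using hole_if_walk_avoiding_neighbours[of adj v x y C "x # ps @ [y]"] nohole sym irrefl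
          SN S ps(5) CR by (auto simp: R_def)
    qed
    moreover have "C \<union> S \<subset> U"
      using v(1) CR SN irrefl by (auto simp: R_def S_def dest: irreflpD)
    moreover have "S \<subset> C \<union> S"
      using c0 unfolding S_def C_def by blast
    ultimately obtain w where w: "w \<in> C" "pairwise adj {z \<in> C \<union> S. adj w z}"
      using psubset.IH[of "C \<union> S" S] by blast
    \<comment> \<open>A neighbour of a vertex of \<open>C\<close> lies in \<open>C\<close> or, by
      the definition of \<open>S\<close>, in \<open>S\<close>; so \<open>w\<close> is simplicial in
      \<open>U\<close> as well.\<close>
    have "{z \<in> U. adj w z} \<subseteq> {z \<in> C \<union> S. adj w z}"
      using w(1) sympD[OF sym] unfolding S_def by blast
    then have "pairwise adj {z \<in> U. adj w z}" using w(2) by (rule pairwise_subset[rotated])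
    moreover have "w \<in> U - K" using w(1) CR v(3) by (auto simp: R_def)
    ultimately show ?thesis by blast
  qed
qed

lemma elimination_list_if_no_hole:
  assumes sym: "symp adj" and irrefl: "irreflp adj" and nohole: "\<nexists>cs. hole adj cs"
    and "finite U" "K \<subseteq> U" "pairwise adj K"
  shows "\<exists>vs. set vs = U - K \<and> elimination_list adj K vs"
  using assms(4-)
proof (induction U rule: finite_psubset_induct)
  case (psubset U)
  show ?case
  proof (cases "K = U")
    case True then show ?thesis by (intro exI[of _ "[]"]) auto
  next
    case False
    then obtain w where w: "w \<in> U - K" "pairwise adj {z \<in> U. adj w z}"
      using simplicial_vertex_outside_clique[OF sym irrefl nohole] psubset by (metis psubsetI)
    then obtain vs where vs: "set vs = U - {w} - K" "elimination_list adj K vs"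
      using psubset.IH[of "U - {w}"] psubset.prems by auto
    have "elimination_list adj K (w # vs)"
      using w vs psubset.prems by (auto intro: pairwise_subset[OF w(2)])
    moreover have "set (w # vs) = U - K" using w vs by auto
    ultimately show ?thesis by blast
  qed
qed

section \<open>Perfect elimination orderings and holes\<close>

lemma perfect_elimination_ordering_if_elimination_list:
  assumes "elimination_list (\<lambda>v w. {v, w} \<in> E) {} vs" "set vs = UNIV" "simple_graph E"
  shows "perfect_elimination_ordering E vs"
proof -
  let ?N = "\<lambda>vs s. {w \<in> set (drop s vs). {vs ! s, w} \<in> E}"
  have "distinct vs \<and> (\<forall>s<length vs. pairwise (\<lambda>x y. {x, y} \<in> E) (?N vs s))"
    using assms(1)
  proof (induction vs)
    case (Cons v vs)
    \<comment> \<open>\<open>drop s vs\<close> still contains \<open>vs ! s\<close> itself; without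
      loops it is not among its own neighbours.\<close>
    have "{v} \<notin> E" using assms(3) by (auto simp: simple_graph_def)
    then have "?N (v # vs) 0 = {w \<in> set vs. {v, w} \<in> E}" by auto
    then show ?case using Cons by (auto simp: less_Suc_eq_0_disj)
  qed simp
  then show ?thesis using assms(2) by (simp add: perfect_elimination_ordering_def)
qed

text \<open>The vertex of the cycle that comes first in the ordering has both its cycle neighbours
  after it; they would have to be adjacent, which is a chord.\<close>

lemma no_hole_if_perfect_elimination_ordering:
  assumes "perfect_elimination_ordering E vs"
  shows "\<not> hole (\<lambda>v w. {v, w} \<in> E) cs"
proof
  let ?n = "length cs"
  assume hole: "hole (\<lambda>v w. {v, w} \<in> E) cs"
  then have dist: "distinct cs" and n: "4 \<le> ?n"
    and adj: "\<And>i j. \<lbrakk>i < ?n; j < ?n\<rbrakk> \<Longrightarrow> {cs ! i, cs ! j} \<in> E \<longleftrightarrow> j = Suc i mod ?n \<or> i = Suc j mod ?n"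
    by (auto simp: hole_def)
  have vs: "distinct vs" "set vs = UNIV"
    "\<And>s. s < length vs \<Longrightarrow> pairwise (\<lambda>x y. {x, y} \<in> E) {w \<in> set (drop s vs). {vs ! s, w} \<in> E}"
    using assms by (auto simp: perfect_elimination_ordering_def)
  define s where "s = (LEAST s. s < length vs \<and> vs ! s \<in> set cs)"
  have "\<exists>s. s < length vs \<and> vs ! s \<in> set cs"
    using n vs(2) by (metis UNIV_I in_set_conv_nth length_greater_0_conv less_le_trans nth_mem zero_less_numeral)
  then have s: "s < length vs" "vs ! s \<in> set cs"
    unfolding s_def by (metis (mono_tags, lifting) LeastI_ex)+
  have sleast: "s \<le> t" if "t < length vs" "vs ! t \<in> set cs" for t
    unfolding s_def using that by (intro Least_le) simp
  have later: "c \<in> set (drop s vs)" if c: "c \<in> set cs" for c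
  proof -
    obtain t where t: "t < length vs" "vs ! t = c" using vs(2) by (metis UNIV_I in_set_conv_nth)
    then have "s \<le> t" using sleast c by simp
    then have "drop s vs ! (t - s) = c" "t - s < length (drop s vs)" using t by auto
    then show ?thesis by (metis nth_mem)
  qed
  obtain i where i: "i < ?n" "cs ! i = vs ! s" using s by (metis in_set_conv_nth)
  define j where "j = Suc i mod ?n"
  \<comment> \<open>The predecessor of \<open>i\<close> on the cycle; adding \<open>?n - 1\<close>
    avoids truncated subtraction at \<open>i = 0\<close>.\<close>
  define k where "k = (i + (?n - 1)) mod ?n"
  have "0 < ?n" using n by linarith
  then have jk: "j < ?n" "k < ?n" unfolding j_def k_def by simp_all
  have k: "k = (if i = 0 then ?n - 1 else i - 1)"
    using i(1) n unfolding k_def by (auto simp: mod_if)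
  have j: "j = (if i = ?n - 1 then 0 else Suc i)"
    using i(1) n unfolding j_def by (auto simp: mod_if)
  have mods: "Suc j mod ?n = (if j = ?n - 1 then 0 else Suc j)"
    "Suc k mod ?n = (if k = ?n - 1 then 0 else Suc k)"
    using jk by (auto simp: mod_if)
  have "j \<noteq> k" "k \<noteq> Suc j mod ?n" "j \<noteq> Suc k mod ?n"
    unfolding mods unfolding j k using i(1) n by (simp_all split: if_split) linarith+
  then have "cs ! j \<noteq> cs ! k" "{cs ! j, cs ! k} \<notin> E"
    using jk dist adj by (auto simp: nth_eq_iff_index_eq)
  moreover have "i = Suc k mod ?n" using i(1) n unfolding mods k by auto
  then have "{cs ! i, cs ! j} \<in> E" "{cs ! i, cs ! k} \<in> E"
    using adj[of i j] adj[of i k] jk i by (auto simp: j_def)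
  ultimately show False
    using vs(3)[OF s(1)] later jk i by (auto simp: pairwise_def)
qed

subsection \<open>Modular flats of a central arrangement\<close>

lemma subset_sums:
  fixes S T :: "'a::monoid_add set"
  shows "0 \<in> T \<Longrightarrow> S \<subseteq> {y + z | y z. y \<in> S \<and> z \<in> T}"
    and "0 \<in> S \<Longrightarrow> T \<subseteq> {y + z | y z. y \<in> S \<and> z \<in> T}"
  by force+

locale central_arrangement =
  fixes W :: "'e::euclidean_space set" and \<A> :: "'e set set"
  assumes subspace_W: "subspace W"
    and hyperplane: "H \<in> \<A> \<Longrightarrow> subspace H \<and> H \<subset> W"
begin

abbreviation "L \<equiv> intersection_poset W \<A>"

text \<open>Every hyperplane contains 0, so all these intersections are nonempty.\<close>

lemma flat_iff: "F \<in> carrier L \<longleftrightarrow> (\<exists>S\<subseteq>\<A>. F = W \<inter> \<Inter>S)"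
proof -
  have "0 \<in> W \<inter> \<Inter>S" if "S \<subseteq> \<A>" for S
    using that hyperplane subspace_0[OF subspace_W] subspace_0 by blast
  then show ?thesis unfolding intersection_poset_def by auto
qed

lemma subspace_flat: "F \<in> carrier L \<Longrightarrow> subspace F"
proof -
  assume "F \<in> carrier L"
  then obtain S where "S \<subseteq> \<A>" "F = W \<inter> \<Inter>S" by (auto simp: flat_iff)
  moreover have "subspace (\<Inter>S)" using hyperplane \<open>S \<subseteq> \<A>\<close> by (intro subspace_Inter) blast
  ultimately show ?thesis using subspace_inter[OF subspace_W] by simp
qed

lemma flat_subset: "F \<in> carrier L \<Longrightarrow> F \<subseteq> W"
  by (auto simp: flat_iff)

lemma flat_W: "W \<in> carrier L"
  unfolding flat_iff by (rule exI[of _ "{}"]) simp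

lemma flat_hyperplane: "H \<in> \<A> \<Longrightarrow> H \<in> carrier L"
  unfolding flat_iff using hyperplane[of H] by (intro exI[of _ "{H}"]) auto

lemma flat_Inter: "S \<subseteq> \<A> \<Longrightarrow> W \<inter> \<Inter>S \<in> carrier L"
  unfolding flat_iff by blast

lemma center_subset_flat: "F \<in> carrier L \<Longrightarrow> W \<inter> \<Inter>\<A> \<subseteq> F"
  unfolding flat_iff by (elim exE conjE) (simp only: Int_mono Inter_anti_mono order_refl)

lemma flat_Int: "F \<in> carrier L \<Longrightarrow> G \<in> carrier L \<Longrightarrow> F \<inter> G \<in> carrier L"
proof -
  assume "F \<in> carrier L" "G \<in> carrier L"
  then obtain S T where "S \<subseteq> \<A>" "T \<subseteq> \<A>" "F = W \<inter> \<Inter>S" "G = W \<inter> \<Inter>T"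
    by (auto simp: flat_iff)
  then show ?thesis unfolding flat_iff by (intro exI[of _ "S \<union> T"]) auto
qed

lemma le_iff: "F \<sqsubseteq>\<^bsub>L\<^esub> G \<longleftrightarrow> G \<subseteq> F"
  by (simp add: intersection_poset_def)

lemma lless_iff: "F \<sqsubset>\<^bsub>L\<^esub> G \<longleftrightarrow> G \<subset> F"
  by (auto simp: intersection_poset_def lless_def)

lemma join_eq:
  assumes "F \<in> carrier L" "G \<in> carrier L"
  shows "F \<squnion>\<^bsub>L\<^esub> G = F \<inter> G"
proof -
  have U: "Upper L {F, G} = {U \<in> carrier L. U \<subseteq> F \<inter> G}"
    using assms by (auto simp: Upper_def le_iff)
  have "least L V (Upper L {F, G}) \<longleftrightarrow> V = F \<inter> G" for V
    using flat_Int[OF assms] unfolding U least_def le_iff by fastforce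
  then show ?thesis by (simp add: join_def sup_def)
qed

text \<open>A flat containing \<open>F\<close> and \<open>G\<close> is cut out by hyperplanes that
  contain both; the smallest one uses all of them.\<close>

lemma meet_eq:
  assumes "F \<in> carrier L" "G \<in> carrier L"
  shows "F \<sqinter>\<^bsub>L\<^esub> G = W \<inter> \<Inter>{H \<in> \<A>. F \<subseteq> H \<and> G \<subseteq> H}"
proof -
  define M where "M = W \<inter> \<Inter>{H \<in> \<A>. F \<subseteq> H \<and> G \<subseteq> H}"
  have U: "U \<in> Lower L {F, G} \<longleftrightarrow> U \<in> carrier L \<and> F \<subseteq> U \<and> G \<subseteq> U" for U
    using assms by (auto simp: Lower_def le_iff)
  have M: "M \<in> Lower L {F, G}"
    using flat_subset[OF assms(1)] flat_subset[OF assms(2)]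
      flat_Inter[of "{H \<in> \<A>. F \<subseteq> H \<and> G \<subseteq> H}"] unfolding U M_def by auto
  have min: "M \<subseteq> U" if "U \<in> Lower L {F, G}" for U
  proof -
    have "U \<in> carrier L" "F \<subseteq> U" "G \<subseteq> U" using that by (simp_all add: U)
    moreover obtain S where "S \<subseteq> \<A>" "U = W \<inter> \<Inter>S"
      using flat_iff[THEN iffD1, OF calculation(1)] by blast
    ultimately have "S \<subseteq> {H \<in> \<A>. F \<subseteq> H \<and> G \<subseteq> H}" by auto
    then show ?thesis unfolding M_def \<open>U = _\<close> by (intro Int_mono Inter_anti_mono order_refl)
  qed
  have g: "greatest L V (Lower L {F, G}) \<longleftrightarrow> V \<in> Lower L {F, G} \<and> (\<forall>U\<in>Lower L {F, G}. U \<sqsubseteq>\<^bsub>L\<^esub> V)" for V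
    by (auto simp: greatest_def Lower_def)
  have "greatest L V (Lower L {F, G}) \<longleftrightarrow> V = M" for V
    unfolding g le_iff using M min by (metis subset_antisym)
  then show ?thesis by (simp add: meet_def inf_def M_def)
qed

text \<open>By the dimension formula for \<open>Y + Z\<close> and \<open>Y \<inter> Z\<close>, the
  rank equation says that the meet and the sum have equal dimension. The meet contains the sum and
  is the smallest flat that does, so they are equal exactly when the sum is a flat.\<close>

lemma modular_element_iff_sums:
  assumes Y: "Y \<in> carrier L"
  shows "modular_element L (codim W) Y \<longleftrightarrow>
    (\<forall>Z\<in>carrier L. {y + z | y z. y \<in> Y \<and> z \<in> Z} \<in> carrier L)"
proof -
  have "codim W Y + codim W Z = codim W (Y \<sqinter>\<^bsub>L\<^esub> Z) + codim W (Y \<squnion>\<^bsub>L\<^esub> Z)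
      \<longleftrightarrow> {y + z | y z. y \<in> Y \<and> z \<in> Z} \<in> carrier L" (is "?l \<longleftrightarrow> ?sum \<in> _")
    if Z: "Z \<in> carrier L" for Z
  proof -
    let ?M = "W \<inter> \<Inter>{H \<in> \<A>. Y \<subseteq> H \<and> Z \<subseteq> H}"
    have sub: "subspace Y" "subspace Z" "subspace (Y \<inter> Z)" "subspace ?sum" "subspace ?M"
      using subspace_flat[OF Y] subspace_flat[OF Z] subspace_flat[OF flat_Int[OF Y Z]]
        subspace_sums[OF subspace_flat[OF Y] subspace_flat[OF Z]]
        subspace_flat[OF flat_Inter[of "{H \<in> \<A>. Y \<subseteq> H \<and> Z \<subseteq> H}"]]
      by blast+
    have "?sum \<subseteq> ?M"
    proof clarify
      fix y z assume "y \<in> Y" "z \<in> Z"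
      moreover have "Y \<subseteq> ?M" "Z \<subseteq> ?M"
        using flat_subset[OF Y] flat_subset[OF Z] by blast+
      ultimately show "y + z \<in> ?M" using subspace_add[OF sub(5)] by blast
    qed
    have "dim ?sum + dim (Y \<inter> Z) = dim Y + dim Z"
      using dim_sums_Int[OF sub(1,2)] by simp
    then have "?l \<longleftrightarrow> dim ?M = dim ?sum"
      unfolding codim_def join_eq[OF Y Z] meet_eq[OF Y Z] sub[THEN aff_dim_subspace]
      by linarith
    also have "\<dots> \<longleftrightarrow> ?sum = ?M"
    proof
      assume "dim ?M = dim ?sum"
      then show "?sum = ?M"
        by (intro subspace_dim_equal[OF sub(4,5) \<open>?sum \<subseteq> ?M\<close>]) simp
    qed (rule arg_cong[OF sym])
    also have "\<dots> \<longleftrightarrow> ?sum \<in> carrier L"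
    proof
      assume "?sum \<in> carrier L"
      then obtain S where S: "S \<subseteq> \<A>" "?sum = W \<inter> \<Inter>S" unfolding flat_iff by blast
      have "Y \<subseteq> ?sum" "Z \<subseteq> ?sum"
        using subset_sums subspace_0[OF sub(1)] subspace_0[OF sub(2)] by blast+
      then have "?M \<subseteq> ?sum" unfolding S(2) using S(1) by blast
      then show "?sum = ?M" using \<open>?sum \<subseteq> ?M\<close> by blast
    next
      assume eq: "?sum = ?M"
      show "?sum \<in> carrier L"
        unfolding eq by (intro flat_Inter Collect_subset)
    qed
    finally show ?thesis .
  qed
  then show ?thesis using Y by (simp add: modular_element_def)
qed

text \<open>Inserting a flat comparable to all members keeps a chain a chain, so maximality says
  that every such flat is already present.\<close>

lemma maxchain_iff:
  "pred_on.maxchain (carrier L) (lless L) C \<longleftrightarrow>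
    C \<subseteq> carrier L \<and> (\<forall>F\<in>C. \<forall>G\<in>C. F \<subseteq> G \<or> G \<subseteq> F) \<and>
    (\<forall>F\<in>carrier L. (\<forall>D\<in>C. F \<subseteq> D \<or> D \<subseteq> F) \<longrightarrow> F \<in> C)"
proof -
  have ch: "pred_on.chain (carrier L) (lless L) C \<longleftrightarrow>
      C \<subseteq> carrier L \<and> (\<forall>F\<in>C. \<forall>G\<in>C. F \<subseteq> G \<or> G \<subseteq> F)" for C
    unfolding pred_on.chain_def lless_iff by auto
  show ?thesis (is "?l \<longleftrightarrow> ?r")
  proof
    assume l: ?l
    then have C: "C \<subseteq> carrier L" "\<forall>F\<in>C. \<forall>G\<in>C. F \<subseteq> G \<or> G \<subseteq> F"
      by (simp_all add: pred_on.maxchain_def ch)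
    have "F \<in> C" if F: "F \<in> carrier L" "\<forall>D\<in>C. F \<subseteq> D \<or> D \<subseteq> F" for F
    proof (rule ccontr)
      assume "F \<notin> C"
      then have "C \<subset> insert F C" by blast
      moreover have "pred_on.chain (carrier L) (lless L) (insert F C)"
        unfolding ch using C F by blast
      ultimately show False using l by (auto simp: pred_on.maxchain_def)
    qed
    then show ?r using C by blast
  next
    assume r: ?r
    have "S = C" if S: "C \<subseteq> S" "pred_on.chain (carrier L) (lless L) S" for S
    proof -
      have "F \<in> C" if "F \<in> S" for F
        using r S that unfolding ch by (meson subsetD)
      then show ?thesis using S by blast
    qed
    then show ?l using r unfolding pred_on.maxchain_def by (metis ch psubset_eq)
  qed
qed

text \<open>\<open>Y\<close> is the smallest member of the chain not contained in all of \<open>\<H>\<close>, and \<open>Y'\<close> the next one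
  below.  Maximality gives \<open>Y \<inter> H = Y'\<close> for every \<open>H\<close> not containing \<open>Y\<close>, so the flat
  \<open>Y + (H \<inter> H')\<close> is not the whole space.\<close>
lemma modular_chain_step:
  assumes max: "pred_on.maxchain (carrier L) (lless L) C"
    and modular: "\<forall>Y\<in>C. modular_element L (codim W) Y"
    and \<H>: "\<H> \<subseteq> \<A>" "\<H> \<noteq> {}"
  obtains Y where "Y \<subseteq> W" "\<exists>H\<in>\<H>. \<not> Y \<subseteq> H"
    "\<And>H H'. \<lbrakk>H \<in> \<H>; H' \<in> \<H>; H \<noteq> H'; \<not> Y \<subseteq> H; \<not> Y \<subseteq> H'\<rbrakk> \<Longrightarrow> \<exists>K\<in>\<A>. Y \<subseteq> K \<and> H \<inter> H' \<subseteq> K"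
proof -
  have C: "C \<subseteq> carrier L" "\<And>F G. F \<in> C \<Longrightarrow> G \<in> C \<Longrightarrow> F \<subseteq> G \<or> G \<subseteq> F"
    and Cmax: "\<And>F. F \<in> carrier L \<Longrightarrow> (\<And>D. D \<in> C \<Longrightarrow> F \<subseteq> D \<or> D \<subseteq> F) \<Longrightarrow> F \<in> C"
    using max unfolding maxchain_iff by blast+
  let ?low = "\<lambda>D. D \<in> C \<and> (\<forall>H\<in>\<H>. D \<subseteq> H)" and ?high = "\<lambda>D. D \<in> C \<and> \<not> (\<forall>H\<in>\<H>. D \<subseteq> H)"
  have dim: "dim F < dim G" if "F \<in> C" "G \<in> C" "F \<subset> G" for F G
  proof -
    have "span F = F" "span G = G"
      using that C(1) subspace_flat by (auto simp only: span_eq_iff)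
    then show ?thesis using that(3) by (metis dim_psubset)
  qed
  \<comment> \<open>The smallest and the largest flat are comparable to all others, hence in
    \<open>C\<close>. The first lies in all of \<open>\<H>\<close>, the second in no member of
    it.\<close>
  have "W \<inter> \<Inter>\<A> \<in> C"
    by (rule Cmax) (use C(1) flat_Inter center_subset_flat in auto)
  then have low: "?low (W \<inter> \<Inter>\<A>)" using \<H> by auto
  have "W \<in> C" using Cmax[of W] flat_W C(1) flat_subset by blast
  then have high: "?high W" using \<H> hyperplane by fastforce
  \<comment> \<open>Dimension is strictly monotone on the chain, so extremal dimensions select the
    largest low and the smallest high member.\<close>
  obtain Y' where Y': "?low Y'" "\<And>D. ?low D \<Longrightarrow> dim D \<le> dim Y'"
    using ex_has_greatest_nat[of ?low, OF low, of dim "Suc DIM('e)"] dim_subset_UNIV[where ?'a='e]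
    by (auto simp: le_imp_less_Suc)
  obtain Y where Y: "?high Y" "\<And>D. ?high D \<Longrightarrow> dim Y \<le> dim D"
    using ex_has_least_nat[of ?high, OF high, of dim] by auto
  have D_low: "D \<subseteq> Y'" if "?low D" for D
    using Y'(2)[OF that] dim[of Y' D] C(2)[of D Y'] Y'(1) that by fastforce
  have D_high: "Y \<subseteq> D" if "?high D" for D
    using Y(2)[OF that] dim[of D Y] C(2)[of D Y] Y(1) that by fastforce
  have "Y' \<subseteq> Y" using C(2)[of Y' Y] Y'(1) Y(1) by blast
  have cut: "Y \<inter> H = Y'" if "H \<in> \<H>" "\<not> Y \<subseteq> H" for H
  proof -
    have "Y \<inter> H \<in> C"
    proof (rule Cmax)
      show "Y \<inter> H \<in> carrier L" using C Y flat_hyperplane that \<H> by (intro flat_Int) auto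
      show "Y \<inter> H \<subseteq> D \<or> D \<subseteq> Y \<inter> H" if "D \<in> C" for D
        using D_low[of D] D_high[of D] that \<open>Y' \<subseteq> Y\<close> Y'(1) \<open>H \<in> \<H>\<close> by blast
    qed
    then have "Y \<inter> H \<subseteq> Y'" using D_low[of "Y \<inter> H"] D_high[of "Y \<inter> H"] that by blast
    then show ?thesis using \<open>Y' \<subseteq> Y\<close> Y'(1) that by blast
  qed
  have "\<exists>K\<in>\<A>. Y \<subseteq> K \<and> H \<inter> H' \<subseteq> K"
    if H: "H \<in> \<H>" "H' \<in> \<H>" "\<not> Y \<subseteq> H" "\<not> Y \<subseteq> H'" and w: "w \<in> H" "w \<notin> H'" for H H' w
  proof -
    define P where "P = {y + z | y z. y \<in> Y \<and> z \<in> H \<inter> H'}"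
    have fl: "Y \<in> carrier L" "H \<inter> H' \<in> carrier L"
      using C Y flat_hyperplane \<H> H by (auto intro!: flat_Int)
    have s: "subspace Y" "subspace H" "subspace H'" "subspace (H \<inter> H')"
      using fl subspace_flat hyperplane \<H> H by blast+
    have "P \<in> carrier L"
      using modular Y(1) fl modular_element_iff_sums[of Y] unfolding P_def by blast
    then obtain S where S: "S \<subseteq> \<A>" "P = W \<inter> \<Inter>S"
      by (auto simp only: flat_iff)
    \<comment> \<open>If \<open>w = y + z\<close>, then \<open>y = w - z\<close> lies in
      \<open>Y \<inter> H = Y'\<close>, hence in \<open>H'\<close>, and then so would
      \<open>w\<close>.\<close>
    have "w \<notin> P"
    proof
      assume "w \<in> P"
      then obtain y z where yz: "w = y + z" "y \<in> Y" "z \<in> H" "z \<in> H'"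
        unfolding P_def by blast
      then have "y \<in> H" using s(2) w(1) by (metis add_diff_cancel_right' subspace_diff)
      then have "y \<in> H'" using cut H yz(2) by blast
      then show False using yz s(3) w(2) by (simp add: subspace_add)
    qed
    moreover have "w \<in> W" using w(1) H(1) \<H> hyperplane by blast
    ultimately obtain K where "K \<in> S" "w \<notin> K" using S(2) by blast
    moreover have "Y \<subseteq> P" "H \<inter> H' \<subseteq> P"
      unfolding P_def by (intro subset_sums subspace_0 s)+
    ultimately show ?thesis using S(1) unfolding S(2) by (meson Inter_lower inf_le2 order_trans subsetD)
  qed
  note sep = this
  have "\<exists>K\<in>\<A>. Y \<subseteq> K \<and> H \<inter> H' \<subseteq> K"
    if H: "H \<in> \<H>" "H' \<in> \<H>" "H \<noteq> H'" "\<not> Y \<subseteq> H" "\<not> Y \<subseteq> H'" for H H'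
  proof -
    consider w where "w \<in> H" "w \<notin> H'" | w where "w \<in> H'" "w \<notin> H"
      using H(3) by blast
    then show ?thesis
    proof cases
      case 1
      then show ?thesis by (rule sep[OF H(1,2,4,5)])
    next
      case 2
      then show ?thesis unfolding Int_commute[of H] by (rule sep[OF H(2,1,5,4)])
    qed
  qed
  moreover have "Y \<subseteq> W" using Y(1) C(1) by (intro flat_subset) blast
  moreover have "\<exists>H\<in>\<H>. \<not> Y \<subseteq> H" using Y(1) by blast
  ultimately show thesis using that[of Y] by blast
qed

end

subsection \<open>The cone of a Dirichlet arrangement\<close>

definition cone_coord :: "'v::finite set \<Rightarrow> ('v \<Rightarrow> real) \<Rightarrow> 'v \<Rightarrow> real \<times> (real ^ 'v) \<Rightarrow> real" where
  "cone_coord B u v p = (if v \<in> B then u v * fst p else snd p $ v)"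

lemma linear_cone_coord: "linear (cone_coord B u v)"
  by (rule linearI) (auto simp: cone_coord_def algebra_simps)

lemma subspace_cone_space: "subspace (cone_space I)"
  by (auto simp: subspace_def cone_space_def zero_prod_def)

locale dirichlet =
  fixes E :: "'v::finite set set" and B :: "'v set" and u :: "'v \<Rightarrow> real"
  assumes simple: "simple_graph E"
    and connected: "graph_connected E"
    and card_B: "card B \<ge> 2"
    and independent: "\<forall>i\<in>B. \<forall>j\<in>B. {i, j} \<notin> E"
    and inj_u: "inj_on u B"
begin

abbreviation "W \<equiv> cone_space (- B)"
abbreviation "\<phi> \<equiv> cone_coord B u"

definition adj :: "'v \<Rightarrow> 'v \<Rightarrow> bool" where
  "adj v w \<longleftrightarrow> {v, w} \<in> add_clique E B"

definition hyp :: "'v \<Rightarrow> 'v \<Rightarrow> (real \<times> (real ^ 'v)) set" where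
  "hyp v w = {p \<in> W. \<phi> v p = \<phi> w p}"

definition arr :: "(real \<times> (real ^ 'v)) set set" where
  "arr = {hyp v w | v w. adj v w}"

lemma hyp_commute: "hyp v w = hyp w v"
  by (auto simp: hyp_def)

lemma hyp_cong: "{v, w} = {v', w'} \<Longrightarrow> hyp v w = hyp v' w'"
  using hyp_commute by (auto simp: doubleton_eq_iff)

lemma edgeD: "{v, w} \<in> E \<Longrightarrow> v \<noteq> w \<and> \<not> (v \<in> B \<and> w \<in> B)"
  using simple independent by (force simp: simple_graph_def)

lemma adj_iff: "adj v w \<longleftrightarrow> {v, w} \<in> E \<or> v \<in> B \<and> w \<in> B \<and> v \<noteq> w"
  by (auto simp: adj_def add_clique_def doubleton_eq_iff)

lemma adj_sym: "adj v w \<Longrightarrow> adj w v"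
  by (simp add: adj_def insert_commute)

lemma adj_neq: "adj v w \<Longrightarrow> v \<noteq> w"
  using edgeD by (auto simp: adj_iff)

lemma two_boundary_vertices: obtains b b' where "b \<in> B" "b' \<in> B" "b \<noteq> b'"
  using card_B card_le_Suc0_iff_eq[of B] by fastforce

text \<open>Injectivity of \<open>u\<close> makes all clique edges on \<open>B\<close> define one
  and the same hyperplane, the one at infinity.\<close>

lemma hyp_boundary:
  assumes "b \<in> B" "b' \<in> B" "b \<noteq> b'"
  shows "hyp b b' = {p \<in> W. fst p = 0}"
  using assms inj_u by (auto simp: hyp_def cone_coord_def dest: inj_onD)

lemma subspace_hyp: "subspace (hyp v w)"
  using subspace_cone_space[of "- B"] linear_cone_coord[of B u]
  by (auto simp: subspace_def hyp_def linear_0 linear_add linear_scale)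

lemma hyp_psubset:
  assumes "adj v w" shows "hyp v w \<subset> W"
proof -
  \<comment> \<open>Raising the interior coordinate \<open>a\<close> alone breaks the
    equation.\<close>
  have *: "hyp a b \<noteq> W" if "a \<notin> B" "a \<noteq> b" for a b
  proof
    assume "hyp a b = W"
    moreover have "(0, axis a 1) \<in> W" using that by (auto simp: cone_space_def axis_def)
    ultimately have "\<phi> a (0, axis a 1) = \<phi> b (0, axis a 1)" by (auto simp: hyp_def)
    then show False using that by (auto simp: cone_coord_def axis_def split: if_splits)
  qed
  have "hyp v w \<noteq> W"
  proof (cases "v \<in> B \<and> w \<in> B")
    case True
    then have "hyp v w = {p \<in> W. fst p = 0}" using assms by (intro hyp_boundary) (auto dest: adj_neq)
    moreover have "(1, 0) \<in> W" "(1, 0) \<notin> {p \<in> W. fst p = 0}" by (simp_all add: cone_space_def)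
    ultimately show ?thesis by metis
  next
    case False
    then show ?thesis using *[of v w] *[of w v] adj_neq[OF assms] hyp_commute by metis
  qed
  then show ?thesis by (auto simp: hyp_def)
qed

sublocale central_arrangement W arr
proof
  fix H assume "H \<in> arr"
  then obtain v w where "H = hyp v w" "adj v w" unfolding arr_def by blast
  then show "subspace H \<and> H \<subset> W" using subspace_hyp hyp_psubset by blast
qed (rule subspace_cone_space)

text \<open>Off \<open>x\<^sub>0 = 0\<close> the cone is the arrangement itself after rescaling; on \<open>x\<^sub>0 = 0\<close> one
  compares with a point of the affine hyperplane.\<close>
lemma homogenization_zero_set:
  assumes e: "{i, j} \<in> E"
    and zero: "{x \<in> dirichlet_space B u. aff_fun (- B) c a x = 0} =
      {x. x $ i = x $ j} \<inter> dirichlet_space B u"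
  shows "{p \<in> W. homogenization (- B) c a p = 0} = hyp i j"
proof -
  have iff: "aff_fun (- B) c a x = 0 \<longleftrightarrow> x $ i = x $ j" if "x \<in> dirichlet_space B u" for x
    using zero that by blast
  have ij: "i \<noteq> j" "\<not> (i \<in> B \<and> j \<in> B)" using edgeD[OF e] by auto
  \<comment> \<open>A point of the affine hyperplane: all interior coordinates take the value of the
    boundary end of the edge, or 0 if there is none.\<close>
  define q :: "real ^ 'v" where
    "q = (\<chi> k. if k \<in> B then u k else if i \<in> B then u i else if j \<in> B then u j else 0)"
  have q: "q \<in> dirichlet_space B u" "q $ i = q $ j"
    using ij by (auto simp: q_def dirichlet_space_def)
  have "homogenization (- B) c a p = 0 \<longleftrightarrow> \<phi> i p = \<phi> j p" if "p \<in> W" for p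
  proof -
    obtain t y where p: "p = (t, y)" by (cases p)
    have y: "y $ k = 0" if "k \<in> B" for k using \<open>p \<in> W\<close> that by (simp add: p cone_space_def)
    show ?thesis
    proof (cases "t = 0")
      case True
      have X: "q + y \<in> dirichlet_space B u"
        using q(1) y by (simp add: dirichlet_space_def)
      \<comment> \<open>At infinity \<open>y\<close> is a direction, and moving the point
        \<open>q\<close> along it changes the affine function by the homogeneous part.\<close>
      have "aff_fun (- B) c a (q + y) = aff_fun (- B) c a q + homogenization (- B) c a p"
        by (simp add: aff_fun_def homogenization_def p True algebra_simps sum.distrib)
      then have "homogenization (- B) c a p = 0 \<longleftrightarrow> y $ i = y $ j"
        using iff[OF X] iff[OF q(1)] q(2) by simp
      then show ?thesis using y by (simp add: cone_coord_def p True)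
    next
      case False
      define x :: "real ^ 'v" where "x = (\<chi> k. if k \<in> B then u k else y $ k / t)"
      have X: "x \<in> dirichlet_space B u" by (simp add: x_def dirichlet_space_def)
      have "(\<Sum>k\<in>- B. a k * x $ k) = (\<Sum>k\<in>- B. a k * y $ k) / t"
        unfolding sum_divide_distrib by (intro sum.cong) (auto simp: x_def)
      then have "homogenization (- B) c a p = t * aff_fun (- B) c a x"
        using False by (simp add: aff_fun_def homogenization_def p algebra_simps)
      moreover have "\<phi> k p = t * x $ k" for k
        using False by (simp add: cone_coord_def p x_def)
      ultimately show ?thesis using iff[OF X] False by simp
    qed
  qed
  then show ?thesis by (auto simp: hyp_def)
qed

lemma affine_equation_of_edge:
  assumes "i \<notin> B" "i \<noteq> j"
  obtains c a where "a i \<noteq> 0"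
    "\<And>x. x \<in> dirichlet_space B u \<Longrightarrow> aff_fun (- B) c a x = x $ i - x $ j"
proof -
  \<comment> \<open>For \<open>j \<in> B\<close> the coefficient of \<open>j\<close> falls outside
    the range of summation, and the constant \<open>- u j\<close> takes its place.\<close>
  define a :: "'v \<Rightarrow> real" where "a k = of_bool (k = i) - of_bool (k = j)" for k
  have "aff_fun (- B) (if j \<in> B then - u j else 0) a x = x $ i - x $ j"
    if "x \<in> dirichlet_space B u" for x
  proof -
    have "(\<Sum>k\<in>- B. a k * x $ k) =
        (\<Sum>k\<in>- B. (if k = i then x $ k else 0)) - (\<Sum>k\<in>- B. (if k = j then x $ k else 0))"
      unfolding sum_subtractf[symmetric] by (intro sum.cong) (auto simp: a_def)
    also have "\<dots> = x $ i - (if j \<in> B then 0 else x $ j)"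
      using assms by simp
    finally show ?thesis using that by (simp add: aff_fun_def dirichlet_space_def)
  qed
  moreover have "a i \<noteq> 0" using assms by (simp add: a_def)
  ultimately show thesis using that by blast
qed

text \<open>The hyperplane at infinity is what the added clique edges stand for. Every other edge
  belongs to \<open>E\<close> and has an interior end, which makes its defining function
  nonconstant.\<close>

lemma cone_dirichlet_arrangement:
  "cone_arrangement (- B) (dirichlet_space B u) (dirichlet_arrangement E B u) = arr"
proof (intro subset_antisym subsetI)
  fix H assume "H \<in> cone_arrangement (- B) (dirichlet_space B u) (dirichlet_arrangement E B u)"
  then consider "H = {p \<in> W. fst p = 0}"
    | c a i j where "H = {p \<in> W. homogenization (- B) c a p = 0}" "{i, j} \<in> E"
      "{x \<in> dirichlet_space B u. aff_fun (- B) c a x = 0} = {x. x $ i = x $ j} \<inter> dirichlet_space B u"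
    unfolding cone_arrangement_def dirichlet_arrangement_def graphic_arrangement_def by blast
  then show "H \<in> arr"
  proof cases
    case 1
    obtain b b' where "b \<in> B" "b' \<in> B" "b \<noteq> b'" by (rule two_boundary_vertices)
    then have "adj b b'" "H = hyp b b'" using 1 by (simp_all add: hyp_boundary adj_iff)
    then show ?thesis unfolding arr_def by blast
  next
    case 2
    then have "H = hyp i j" "adj i j" using homogenization_zero_set by (simp_all add: adj_iff)
    then show ?thesis unfolding arr_def by blast
  qed
next
  fix H assume "H \<in> arr"
  then obtain v w where H: "H = hyp v w" "adj v w" unfolding arr_def by blast
  show "H \<in> cone_arrangement (- B) (dirichlet_space B u) (dirichlet_arrangement E B u)"
  proof (cases "v \<in> B \<and> w \<in> B")
    case True
    then have "H = {p \<in> W. fst p = 0}" using H adj_neq hyp_boundary by simp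
    then show ?thesis by (simp add: cone_arrangement_def)
  next
    case False
    then obtain i j where ij: "{v, w} = {i, j}" "i \<notin> B" by (metis insert_commute)
    have "{v, w} \<in> E" using H(2) False by (auto simp: adj_iff)
    then have e: "{i, j} \<in> E" using ij(1) by simp
    obtain c a where ca: "a i \<noteq> 0"
      "\<And>x. x \<in> dirichlet_space B u \<Longrightarrow> aff_fun (- B) c a x = x $ i - x $ j"
      using affine_equation_of_edge[of i j] ij(2) edgeD[OF e] by metis
    have zero: "{x \<in> dirichlet_space B u. aff_fun (- B) c a x = 0} =
        {x. x $ i = x $ j} \<inter> dirichlet_space B u"
      using ca(2) by auto
    have "H = {p \<in> W. homogenization (- B) c a p = 0}"
      using homogenization_zero_set[OF e zero] hyp_cong[OF ij(1)] H(1) by simp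
    moreover have "{x. x $ i = x $ j} \<inter> dirichlet_space B u \<in> dirichlet_arrangement E B u"
      unfolding dirichlet_arrangement_def graphic_arrangement_def using e by blast
    ultimately show ?thesis
      unfolding cone_arrangement_def using ca(1) ij(2) zero
      by (intro insertI2 CollectI exI[of _ c] exI[of _ a]) auto
  qed
qed

section \<open>Equation systems and elimination of coordinates\<close>

definition sol :: "('v \<times> 'v) set \<Rightarrow> (real \<times> (real ^ 'v)) set" where
  "sol P = {p \<in> W. \<forall>(v, w)\<in>P. \<phi> v p = \<phi> w p}"

text \<open>Symmetry of \<open>P\<close> allows elimination to find all equations involving a vertex
  among the pairs that start with it.\<close>

lemma flat_iff_sol: "F \<in> carrier L \<longleftrightarrow> (\<exists>P. sym P \<and> P \<subseteq> {(v, w). adj v w} \<and> F = sol P)"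
proof
  assume "F \<in> carrier L"
  then obtain S where S: "S \<subseteq> arr" "F = W \<inter> \<Inter>S" by (auto simp only: flat_iff)
  define P where "P = {(v, w). adj v w \<and> hyp v w \<in> S}"
  have "sym P" using adj_sym hyp_commute by (auto simp: P_def sym_def)
  moreover have "F = sol P"
  proof (intro subset_antisym subsetI)
    fix p assume "p \<in> F"
    then show "p \<in> sol P" using S(2) by (auto simp: sol_def P_def hyp_def)
  next
    fix p assume p: "p \<in> sol P"
    have "p \<in> H" if H: "H \<in> S" for H
    proof -
      obtain v w where vw: "H = hyp v w" "adj v w" using S(1) H unfolding arr_def by blast
      then have "(v, w) \<in> P" using H by (simp add: P_def)
      then show ?thesis using p vw by (auto simp: sol_def hyp_def)
    qed
    then show "p \<in> F" using p S(2) by (auto simp: sol_def)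
  qed
  ultimately show "\<exists>P. sym P \<and> P \<subseteq> {(v, w). adj v w} \<and> F = sol P"
    by (intro exI[of _ P]) (auto simp: P_def)
next
  assume "\<exists>P. sym P \<and> P \<subseteq> {(v, w). adj v w} \<and> F = sol P"
  then obtain P where P: "P \<subseteq> {(v, w). adj v w}" "F = sol P" by blast
  have "F = W \<inter> \<Inter>((\<lambda>(v, w). hyp v w) ` P)"
    unfolding P(2) by (auto simp: sol_def hyp_def)
  moreover have "(\<lambda>(v, w). hyp v w) ` P \<subseteq> arr"
    using P(1) unfolding arr_def by auto
  ultimately show "F \<in> carrier L" using flat_Inter by simp
qed

definition agree :: "'v set \<Rightarrow> real \<times> (real ^ 'v) \<Rightarrow> real \<times> (real ^ 'v) \<Rightarrow> bool" where
  "agree T p q \<longleftrightarrow> fst p = fst q \<and> (\<forall>i\<in>T. snd p $ i = snd q $ i)"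

text \<open>The cylinder in \<open>W\<close> over the projection of \<open>F\<close> to
  \<open>x\<^sub>0\<close> and the coordinates in \<open>T\<close>, that is, the result of
  eliminating the remaining coordinates.\<close>

definition forget :: "'v set \<Rightarrow> (real \<times> (real ^ 'v)) set \<Rightarrow> (real \<times> (real ^ 'v)) set" where
  "forget T F = {p \<in> W. \<exists>q\<in>F. agree T p q}"

lemma forget_forget:
  assumes "T \<subseteq> T'" "F \<subseteq> W" shows "forget T (forget T' F) = forget T F"
proof (intro subset_antisym subsetI)
  fix p assume "p \<in> forget T (forget T' F)"
  then obtain q r where "p \<in> W" "agree T p q" "agree T' q r" "r \<in> F"
    by (auto simp: forget_def)
  then have "agree T p r" using assms(1) by (auto simp: agree_def)
  then show "p \<in> forget T F" using \<open>p \<in> W\<close> \<open>r \<in> F\<close> by (auto simp: forget_def)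
next
  fix p assume "p \<in> forget T F"
  then obtain q where q: "p \<in> W" "agree T p q" "q \<in> F"
    by (auto simp: forget_def)
  then have "q \<in> forget T' F" using assms(2) unfolding forget_def agree_def by blast
  then show "p \<in> forget T (forget T' F)" using q unfolding forget_def by blast
qed

lemma forget_interior:
  assumes "F \<subseteq> W" shows "forget (- B) F = F"
proof -
  have "p = q" if "agree (- B) p q" "p \<in> W" "q \<in> W" for p q
    using that by (auto simp: agree_def cone_space_def prod_eq_iff vec_eq_iff)
  note eq = this
  show ?thesis
  proof (intro subset_antisym subsetI)
    fix p assume "p \<in> forget (- B) F"
    then obtain q where q: "p \<in> W" "q \<in> F" "agree (- B) p q" unfolding forget_def by blast
    then have "p = q" using eq assms by blast
    then show "p \<in> F" using q(2) by simp
  next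
    fix p assume "p \<in> F"
    moreover have "agree (- B) p p" by (simp add: agree_def)
    ultimately show "p \<in> forget (- B) F" using assms unfolding forget_def by blast
  qed
qed

lemma cone_coord_agree: "agree T p q \<Longrightarrow> v \<in> T \<union> B \<Longrightarrow> \<phi> v p = \<phi> v q"
  by (auto simp: agree_def cone_coord_def)

text \<open>The equations involving \<open>i\<close> prescribe its coordinate as
  \<open>\<phi> j\<close> for each \<open>j \<in> N\<close>. They are solvable exactly when these
  values agree, and pairs from \<open>N\<close> are edges because the neighbours of \<open>i\<close>
  form a clique.\<close>

lemma eliminate_simplicial:
  assumes P: "sym P" "P \<subseteq> {(v, w). adj v w}" "P \<subseteq> (insert i T \<union> B) \<times> (insert i T \<union> B)"
    and i: "i \<notin> T \<union> B" and clique: "pairwise adj {w \<in> T \<union> B. adj i w}"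
  obtains P' where "sym P'" "P' \<subseteq> {(v, w). adj v w}" "P' \<subseteq> (T \<union> B) \<times> (T \<union> B)"
    "forget T (sol P) = sol P'"
proof -
  define N where "N = {j. (i, j) \<in> P}"
  define P' where "P' = {(v, w) \<in> P. v \<noteq> i \<and> w \<noteq> i} \<union> {(j, k). j \<in> N \<and> k \<in> N \<and> j \<noteq> k}"
  have N: "j \<noteq> i" "j \<in> T \<union> B" "adj i j" if "j \<in> N" for j
    using that P(2,3) adj_neq[of i j] by (auto simp: N_def)
  have "sym P'" using P(1) by (auto simp: P'_def sym_def)
  moreover have "P' \<subseteq> {(v, w). adj v w}"
    using P(2) N clique by (auto simp: P'_def pairwise_def)
  moreover have P'3: "P' \<subseteq> (T \<union> B) \<times> (T \<union> B)"
    using P(3) N by (auto simp: P'_def)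
  moreover have "forget T (sol P) = sol P'"
  proof (intro subset_antisym subsetI)
    fix p assume "p \<in> forget T (sol P)"
    then obtain q where q: "p \<in> W" "q \<in> sol P" "agree T p q" by (auto simp: forget_def)
    have eq: "\<phi> v p = \<phi> v q" if "v \<in> T \<union> B" for v
      using cone_coord_agree q(3) that by blast
    have "\<phi> v q = \<phi> w q" if "(v, w) \<in> P" for v w
      using q(2) that by (auto simp: sol_def)
    then have "\<phi> v q = \<phi> w q" if "(v, w) \<in> P'" for v w
      using that unfolding P'_def N_def by (auto; metis)
    then show "p \<in> sol P'" using q(1) P'3 eq by (fastforce simp: sol_def)
  next
    fix p assume p: "p \<in> sol P'"
    then have pW: "p \<in> W" by (simp add: sol_def)
    have p': "\<phi> v p = \<phi> w p" if "(v, w) \<in> P'" for v w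
      using p that by (auto simp: sol_def)
    \<comment> \<open>Coordinate \<open>i\<close> is set to the common value prescribed by
      \<open>N\<close>, or left alone if \<open>N\<close> is empty.\<close>
    obtain q where q: "q \<in> W" "\<And>v. v \<noteq> i \<Longrightarrow> \<phi> v q = \<phi> v p" "\<And>j. j \<in> N \<Longrightarrow> \<phi> i q = \<phi> j p"
      "agree T p q"
    proof (cases "N = {}")
      case True
      then show ?thesis using that[of p] pW by (simp add: agree_def)
    next
      case False
      then obtain j where j: "j \<in> N" by blast
      define q :: "real \<times> (real ^ 'v)" where
        "q = (fst p, \<chi> k. if k = i then \<phi> j p else snd p $ k)"
      have "q \<in> W" using pW i by (auto simp: q_def cone_space_def)
      moreover have "\<phi> v q = \<phi> v p" if "v \<noteq> i" for v
        using that by (simp add: q_def cone_coord_def)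
      moreover have "\<phi> i q = \<phi> k p" if "k \<in> N" for k
      proof -
        have "\<phi> i q = \<phi> j p" using i by (simp add: q_def cone_coord_def)
        moreover have "j = k \<or> (j, k) \<in> P'" using j that by (auto simp: P'_def)
        ultimately show ?thesis using p' by auto
      qed
      moreover have "agree T p q" using i by (auto simp: agree_def q_def)
      ultimately show ?thesis by (rule that)
    qed
    have "\<phi> v q = \<phi> w q" if vw: "(v, w) \<in> P" for v w
    proof -
      consider "v = i" | "w = i" "v \<noteq> i" | "v \<noteq> i" "w \<noteq> i" by blast
      then show ?thesis
      proof cases
        case 1
        then have "w \<in> N" using vw by (simp add: N_def)
        then show ?thesis using q N(1) 1 by simp
      next
        case 2
        then have "v \<in> N" using vw symD[OF P(1)] by (simp add: N_def)
        then show ?thesis using q 2 by simp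
      next
        case 3
        then have "(v, w) \<in> P'" using vw by (simp add: P'_def)
        then show ?thesis using q 3 p' by simp
      qed
    qed
    then have "q \<in> sol P" using q(1) by (auto simp: sol_def)
    then show "p \<in> forget T (sol P)" using q(4) pW by (auto simp: forget_def)
  qed
  ultimately show thesis by (rule that)
qed

text \<open>The coordinates in \<open>us\<close> are eliminated one by one; each new system involves
  only later vertices and the boundary.\<close>

lemma forget_flat:
  assumes "elimination_list adj B (us @ vs)"
    and "sym P" "P \<subseteq> {(v, w). adj v w}" "P \<subseteq> (set (us @ vs) \<union> B) \<times> (set (us @ vs) \<union> B)"
  shows "forget (set vs) (sol P) \<in> carrier L"
  using assms
proof (induction us arbitrary: P)
  case Nil
  have "forget (set vs) (sol P) = sol P"
  proof (intro subset_antisym subsetI)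
    fix p assume "p \<in> forget (set vs) (sol P)"
    then obtain q where q: "p \<in> W" "q \<in> sol P" "agree (set vs) p q" by (auto simp: forget_def)
    then show "p \<in> sol P"
      using Nil.prems(4) cone_coord_agree[OF q(3)] by (fastforce simp: sol_def)
  qed (auto simp: forget_def agree_def sol_def)
  then show ?case using Nil.prems flat_iff_sol by auto
next
  case (Cons i us)
  let ?T = "set (us @ vs)"
  have "i \<notin> ?T \<union> B" "pairwise adj {w \<in> ?T \<union> B. adj i w}" "elimination_list adj B (us @ vs)"
    using Cons.prems(1) by simp_all
  moreover from this obtain P' where P': "sym P'" "P' \<subseteq> {(v, w). adj v w}"
    "P' \<subseteq> (?T \<union> B) \<times> (?T \<union> B)" "forget ?T (sol P) = sol P'"
    using eliminate_simplicial[of P i ?T] Cons.prems(2-4) by auto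
  ultimately have "forget (set vs) (sol P') \<in> carrier L"
    using Cons.IH by blast
  moreover have "forget (set vs) (forget ?T (sol P)) = forget (set vs) (sol P)"
    by (rule forget_forget) (auto simp: sol_def)
  ultimately show ?case using P'(4) by simp
qed

text \<open>Connectedness makes all \<open>\<phi> v\<close> equal, and two boundary vertices force
  \<open>x\<^sub>0 = 0\<close>, so the common value is 0.\<close>

lemma center: "W \<inter> \<Inter>arr = {0}"
proof
  show "W \<inter> \<Inter>arr \<subseteq> {0}"
  proof
    fix p assume p: "p \<in> W \<inter> \<Inter>arr"
    have step: "\<phi> v p = \<phi> w p" if "adj v w" for v w
      using p that unfolding arr_def hyp_def by blast
    have const: "\<phi> v p = \<phi> w p" for v w
    proof -
      have "(v, w) \<in> {(x, y). {x, y} \<in> E}\<^sup>*"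
        using connected by (simp add: graph_connected_def)
      then show ?thesis
        by (induction rule: rtrancl_induct) (use step in \<open>auto simp: adj_iff\<close>)
    qed
    obtain b b' where b: "b \<in> B" "b' \<in> B" "b \<noteq> b'" by (rule two_boundary_vertices)
    then have "p \<in> hyp b b'" using const p by (simp add: hyp_def)
    then have "fst p = 0" using b by (simp add: hyp_boundary)
    then have "\<phi> b p = 0" using b by (simp add: cone_coord_def)
    then have "\<phi> v p = 0" for v using const by metis
    then have zero: "\<phi> v p = 0" for v by blast
    have "snd p $ v = 0" for v
    proof (cases "v \<in> B")
      case True
      then show ?thesis using p by (auto simp: cone_space_def)
    next
      case False
      then show ?thesis using zero[of v] by (simp add: cone_coord_def)
    qed
    then show "p \<in> {0}" using \<open>fst p = 0\<close> by (simp add: prod_eq_iff vec_eq_iff)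
  qed
  show "{0} \<subseteq> W \<inter> \<Inter>arr"
    using subspace_0[OF subspace_flat[OF flat_Inter[of arr]]] by simp
qed

section \<open>The modular maximal chain of an elimination list\<close>

text \<open>The flat \<open>Y\<^sub>T\<close>: since \<open>agree\<close> also compares first
  components, \<open>x\<^sub>0 = 0\<close> is included.\<close>

definition vanishing :: "'v set \<Rightarrow> (real \<times> (real ^ 'v)) set" where
  "vanishing T = {p \<in> W. agree T p 0}"

lemma subspace_vanishing: "subspace (vanishing T)"
  using subspace_cone_space[of "- B"] by (auto simp: subspace_def vanishing_def agree_def)

lemma forget_0: "forget T {0} = vanishing T"
  by (auto simp: forget_def vanishing_def)

text \<open>Vectors of \<open>vanishing T\<close> are arbitrary in the interior coordinates outside
  \<open>T\<close>. This turns the sums of the modularity criterion into eliminations.\<close>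

lemma vanishing_sums:
  assumes "F \<subseteq> W"
  shows "{y + z | y z. y \<in> vanishing T \<and> z \<in> F} = forget T F"
proof (intro subset_antisym subsetI)
  fix p assume "p \<in> {y + z | y z. y \<in> vanishing T \<and> z \<in> F}"
  then obtain y z where yz: "p = y + z" "y \<in> vanishing T" "z \<in> F" by blast
  have "p \<in> W"
    unfolding yz(1) using yz(2,3) assms
    by (intro subspace_add subspace_cone_space) (auto simp: vanishing_def)
  moreover have "agree T p z"
    using yz(2) by (simp add: yz(1) vanishing_def agree_def)
  ultimately
  show "p \<in> forget T F" using yz(3) unfolding forget_def by blast
next
  fix p assume "p \<in> forget T F"
  then obtain z where z: "p \<in> W" "z \<in> F" "agree T p z" unfolding forget_def by blast
  then have "p - z \<in> W"
    using assms by (intro subspace_diff subspace_cone_space) auto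
  then have "p - z \<in> vanishing T"
    using z(3) by (simp add: vanishing_def agree_def)
  then have "p - z + z \<in> {y + z | y z. y \<in> vanishing T \<and> z \<in> F}" using z(2) by blast
  then show "p \<in> {y + z | y z. y \<in> vanishing T \<and> z \<in> F}" by simp
qed

lemma forget_suffix_flat:
  assumes vs: "elimination_list adj B vs" "set vs = - B" and F: "F \<in> carrier L"
  shows "forget (set (drop s vs)) F \<in> carrier L"
proof -
  obtain P where P: "sym P" "P \<subseteq> {(v, w). adj v w}" "F = sol P"
    using F flat_iff_sol by blast
  have "set (take s vs @ drop s vs) \<union> B = UNIV" using vs(2) by auto
  then show ?thesis
    using forget_flat[of "take s vs" "drop s vs" P] P vs(1) by auto
qed

text \<open>The flat itself arises by elimination from the centre, and its sums with other flats by
  elimination from these.\<close>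

lemma modular_vanishing:
  assumes vs: "elimination_list adj B vs" "set vs = - B"
  shows "modular_element L (codim W) (vanishing (set (drop s vs)))"
proof -
  have "{0} \<in> carrier L" using flat_Inter[of arr] center by simp
  then have flat: "vanishing (set (drop s vs)) \<in> carrier L"
    using forget_suffix_flat[OF vs] forget_0 by metis
  then show ?thesis
    unfolding modular_element_iff_sums[OF flat]
    by (intro ballI) (simp only: vanishing_sums[OF flat_subset] forget_suffix_flat[OF vs])
qed

text \<open>A vector \<open>p\<close> of \<open>F\<close> with \<open>f p \<noteq> 0\<close>
  complements the kernel of \<open>f\<close> in \<open>G\<close>, and \<open>F\<close> contains that
  kernel too.\<close>

lemma subspace_eq_if_codim_le_one:
  fixes f :: "'e::real_vector \<Rightarrow> real"
  assumes "linear f" "subspace F" "F \<subseteq> G" "{p \<in> G. f p = 0} \<subseteq> F" "subspace G" "\<not> F \<subseteq> {p \<in> G. f p = 0}"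
  shows "F = G"
proof -
  obtain p where p: "p \<in> F" "f p \<noteq> 0" using assms(3,6) by blast
  have "q \<in> F" if "q \<in> G" for q
  proof -
    define r where "r = q - (f q / f p) *\<^sub>R p"
    have "f r = 0"
      using assms(1) p by (simp add: r_def linear_diff linear_scale)
    moreover have "r \<in> G"
      using assms(3,5) p that by (auto simp: r_def intro!: subspace_diff subspace_scale)
    ultimately have "r \<in> F" using assms(4) by blast
    then have "r + (f q / f p) *\<^sub>R p \<in> F"
      using assms(2) p by (intro subspace_add subspace_scale)
    then show ?thesis by (simp add: r_def)
  qed
  then show ?thesis using assms(3) by blast
qed

text \<open>Consecutive members differ by one linear equation, which leaves no room for a further
  subspace between them.\<close>

lemma maxchain_vanishing:
  assumes vs: "elimination_list adj B vs" "set vs = - B"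
  shows "pred_on.maxchain (carrier L) (lless L)
    (insert W ((\<lambda>s. vanishing (set (drop s vs))) ` {..length vs}))" (is "pred_on.maxchain _ _ ?C")
proof -
  let ?N = "\<lambda>s. vanishing (set (drop s vs))"
  have mono: "?N s \<subseteq> ?N t" if "s \<le> t" for s t
    using set_drop_subset_set_drop[OF that, of vs] by (auto simp: vanishing_def agree_def)
  have flat: "?N s \<in> carrier L" for s
    using modular_vanishing[OF vs] by (simp add: modular_element_def)
  have C: "?C \<subseteq> carrier L" using flat flat_W by auto
  have lin: "F \<subseteq> G \<or> G \<subseteq> F" if FG: "F \<in> ?C" "G \<in> ?C" for F G
  proof (cases "F = W \<or> G = W")
    case True then show ?thesis using FG C flat_subset by blast
  next
    case False
    then obtain s t where "F = ?N s" "G = ?N t" using FG by blast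
    then show ?thesis using mono by (metis nat_le_linear)
  qed
  have max: "F \<in> ?C" if F: "F \<in> carrier L" and cmp: "\<And>D. D \<in> ?C \<Longrightarrow> F \<subseteq> D \<or> D \<subseteq> F" for F
  proof (cases "F \<subseteq> ?N (length vs)")
    case False
    \<comment> \<open>Dropping all of \<open>vs\<close> leaves only \<open>x\<^sub>0 = 0\<close>, a
      hyperplane of \<open>W\<close>.\<close>
    have "?N (length vs) = {p \<in> W. fst p = 0}" by (auto simp: vanishing_def agree_def)
    moreover have "?N (length vs) \<subseteq> F" using False cmp[of "?N (length vs)"] by blast
    ultimately have "F = W"
      using subspace_eq_if_codim_le_one[of fst F W] linear_fst flat_subset[OF F]
        subspace_flat[OF F] subspace_W False by auto
    then show ?thesis by simp
  next
    case True
    \<comment> \<open>The least member of the chain containing \<open>F\<close>; the preceding one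
      is cut out of it by a single coordinate, and for \<open>s = 0\<close> only 0 is left.\<close>
    define s where "s = (LEAST s. F \<subseteq> ?N s)"
    have s: "F \<subseteq> ?N s" unfolding s_def using True by (rule LeastI)
    have sl: "s \<le> length vs" unfolding s_def using True by (rule Least_le)
    show ?thesis
    proof (cases s)
      case 0
      have "?N 0 = {0}"
        using forget_0[of "- B"] forget_interior[of "{0}"] subspace_0[OF subspace_W] vs(2) by simp
      then have "F = ?N 0" using s 0 subspace_0[OF subspace_flat[OF F]] by auto
      then show ?thesis by blast
    next
      case (Suc t)
      then have tl: "t < length vs" using sl by simp
      have nt: "\<not> F \<subseteq> ?N t" using not_less_Least[of t "\<lambda>s. F \<subseteq> ?N s"] Suc s_def by simp
      then have le: "?N t \<subseteq> F" using cmp[of "?N t"] tl by fastforce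
      have eq: "?N t = {p \<in> ?N s. snd p $ (vs ! t) = 0}"
        unfolding Suc Cons_nth_drop_Suc[OF tl, symmetric] by (auto simp: vanishing_def agree_def)
      have "linear (\<lambda>p :: real \<times> (real ^ 'v). snd p $ (vs ! t))"
        by (rule linearI) auto
      then have "F = ?N s"
        using subspace_eq_if_codim_le_one[of _ F "?N s"] s le nt subspace_vanishing
          subspace_flat[OF F] unfolding eq by blast
      then show ?thesis using sl by blast
    qed
  qed
  show ?thesis
    unfolding maxchain_iff
  proof (intro conjI ballI impI)
    show "?C \<subseteq> carrier L" by (rule C)
    show "F \<subseteq> G \<or> G \<subseteq> F" if "F \<in> ?C" "G \<in> ?C" for F G
      using that by (rule lin)
    show "F \<in> ?C" if "F \<in> carrier L" "\<forall>D\<in>?C. F \<subseteq> D \<or> D \<subseteq> F" for F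
      using that(1) that(2)[rule_format] by (rule max)
  qed
qed

section \<open>Generic points and inclusions between flats\<close>

text \<open>Distinct values for all vertices serve to build points whose coordinates coincide only
  where prescribed.\<close>

lemma injective_extension: obtains h :: "'v \<Rightarrow> real" where "inj h" "\<And>b. b \<in> B \<Longrightarrow> h b = u b"
proof -
  have "infinite (UNIV - u ` B :: real set)"
    using infinite_UNIV_char_0[where ?'a = real] by (intro Diff_infinite_finite) auto
  then obtain X where X: "X \<subseteq> UNIV - u ` B" "finite X" "card X = card (- B)"
    using infinite_arbitrarily_large[of _ "card (- B)"] by metis
  then obtain g where g: "bij_betw g (- B) X"
    using finite_same_card_bij[of "- B" X] by auto
  define h where "h v = (if v \<in> B then u v else g v)" for v
  have g': "g v \<noteq> u b" if "v \<notin> B" "b \<in> B" for v b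
    using bij_betwE[OF g] X(1) that by blast
  have "inj h"
  proof (rule injI)
    fix v w assume eq: "h v = h w"
    then have "v \<in> B \<longleftrightarrow> w \<in> B"
      using g'[of v w] g'[of w v] by (auto simp: h_def split: if_splits)
    then show "v = w"
      using eq inj_onD[OF inj_u, of v w] inj_onD[OF bij_betw_imp_inj_on[OF g], of v w]
      by (cases "v \<in> B") (auto simp: h_def)
  qed
  then show thesis using that[of h] by (simp add: h_def)
qed

text \<open>A map that merges vertices, at most one boundary vertex per class, is realised by a
  point of the cone with \<open>x\<^sub>0 = 1\<close>; a map that merges the whole boundary, by one with
  \<open>x\<^sub>0 = 0\<close>.\<close>
lemma generic_point:
  assumes "\<And>b. b \<in> B \<Longrightarrow> f b = b"
  obtains p where "\<And>v w. p \<in> hyp v w \<longleftrightarrow> f v = f w"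
proof -
  obtain h :: "'v \<Rightarrow> real" where h: "inj h" "\<And>b. b \<in> B \<Longrightarrow> h b = u b"
    using injective_extension by blast
  define p :: "real \<times> (real ^ 'v)" where "p = (1, \<chi> v. if v \<in> B then 0 else h (f v))"
  have "p \<in> W" by (simp add: p_def cone_space_def)
  moreover have "\<phi> v p = h (f v)" for v
    using assms h(2) by (simp add: p_def cone_coord_def)
  ultimately show thesis using that[of p] h(1) by (simp add: hyp_def inj_eq)
qed

lemma generic_point_at_infinity:
  fixes f :: "'v \<Rightarrow> 'v"
  assumes "\<And>b. b \<in> B \<Longrightarrow> f b = b0"
  obtains p where "\<And>v w. p \<in> hyp v w \<longleftrightarrow> f v = f w"
proof -
  obtain h :: "'v \<Rightarrow> real" where h: "inj h" "\<And>b. b \<in> B \<Longrightarrow> h b = u b"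
    using injective_extension by blast
  \<comment> \<open>The shift by \<open>h b0\<close> gives the class of the boundary the value 0, as
    \<open>x\<^sub>0 = 0\<close> requires.\<close>
  define p :: "real \<times> (real ^ 'v)" where
    "p = (0, \<chi> v. if v \<in> B then 0 else h (f v) - h b0)"
  have "p \<in> W" by (simp add: p_def cone_space_def)
  moreover have "\<phi> v p = h (f v) - h b0" for v
    using assms by (simp add: p_def cone_coord_def)
  ultimately show thesis using that[of p] h(1) by (simp add: hyp_def inj_eq)
qed

text \<open>The point satisfying exactly the equations merged by \<open>f\<close> lies in
  \<open>S\<close>, hence in \<open>hyp p q\<close>. So a well-chosen \<open>f\<close> tests an
  inclusion.\<close>

lemma ends_merged:
  assumes "S \<subseteq> hyp p q" "\<And>b. b \<in> B \<Longrightarrow> f b = b"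
    "\<And>x. (\<And>v w. x \<in> hyp v w \<longleftrightarrow> f v = f w) \<Longrightarrow> x \<in> S"
  shows "f p = f q"
  using assms generic_point[of f] by (metis subsetD)

lemma ends_merged_at_infinity:
  fixes f :: "'v \<Rightarrow> 'v"
  assumes "S \<subseteq> hyp p q" "\<And>b. b \<in> B \<Longrightarrow> f b = b0"
    "\<And>x. (\<And>v w. x \<in> hyp v w \<longleftrightarrow> f v = f w) \<Longrightarrow> x \<in> S"
  shows "f p = f q"
  using assms generic_point_at_infinity[of f b0] by (metis subsetD)

lemma hyp_subset_imp_eq:
  assumes "hyp a b \<subseteq> hyp c d" "c \<noteq> d" "\<not> (a \<in> B \<and> b \<in> B)"
  shows "{a, b} = {c, d}"
proof -
  have *: "{a, b} = {c, d}" if "hyp a b \<subseteq> hyp c d" "a \<notin> B" for a b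
  proof -
    have "(id(a := b)) c = (id(a := b)) d"
      by (rule ends_merged[OF that(1), of "id(a := b)"]) (use that(2) in auto)
    then show ?thesis using assms(2) by (auto split: if_splits)
  qed
  show ?thesis using *[of a b] *[of b a] assms hyp_commute by (metis insert_commute)
qed

lemma interior_end:
  assumes "\<not> (a \<in> B \<and> b \<in> B)"
  obtains a' b' where "{a, b} = {a', b'}" "a' \<notin> B"
proof (cases "a \<in> B")
  case True
  then show thesis using assms that[of b a] by (simp add: insert_commute)
next
  case False
  then show thesis using that[of a b] by simp
qed

text \<open>If the edges are disjoint, merging the ends of each identifies no further pair, so there
  is no third edge. If they share \<open>x\<close>, merging \<open>x\<close>, \<open>y\<close>,
  \<open>z\<close> leaves only \<open>{y, z}\<close> for it.\<close>

lemma third_hyperplane: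
  assumes ab: "a \<noteq> b" "\<not> (a \<in> B \<and> b \<in> B)" and cd: "c \<noteq> d" "\<not> (c \<in> B \<and> d \<in> B)"
    and ne: "{a, b} \<noteq> {c, d}"
    and pq: "adj p q" "{p, q} \<noteq> {a, b}" "{p, q} \<noteq> {c, d}"
    and sub: "hyp a b \<inter> hyp c d \<subseteq> hyp p q"
  obtains x y z where "{a, b} = {x, y}" "{c, d} = {x, z}" "y \<noteq> z" "adj y z"
proof (cases "{a, b} \<inter> {c, d} = {}")
  case True
  have "{p, q} = {a', b'} \<or> {p, q} = {c', d'}"
    if "a' \<notin> B" "c' \<notin> B" "{a, b} = {a', b'}" "{c, d} = {c', d'}" for a' b' c' d'
  proof -
    have s: "hyp a' b' \<inter> hyp c' d' \<subseteq> hyp p q"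
      using sub hyp_cong[OF that(3)] hyp_cong[OF that(4)] by simp
    have dj: "a' \<noteq> c'" "a' \<noteq> d'" "b' \<noteq> c'" "b' \<noteq> d'" using True that(3,4) by auto
    have "(id(a' := b', c' := d')) p = (id(a' := b', c' := d')) q"
      by (rule ends_merged[OF s, of "id(a' := b', c' := d')"]) (use that(1,2) dj in auto)
    then show ?thesis using adj_neq[OF pq(1)] dj by (auto split: if_splits)
  qed
  moreover obtain a' b' where "a' \<notin> B" "{a, b} = {a', b'}" using interior_end[OF ab(2)] by metis
  moreover obtain c' d' where "c' \<notin> B" "{c, d} = {c', d'}" using interior_end[OF cd(2)] by metis
  ultimately show thesis using pq(2,3) by metis
next
  case False
  then obtain x where x: "x \<in> {a, b}" "x \<in> {c, d}" by blast
  obtain y where "{a, b} = {x, y}" using x(1) by auto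
  moreover obtain z where "{c, d} = {x, z}" using x(2) by auto
  ultimately have xyz: "{a, b} = {x, y}" "{c, d} = {x, z}" by simp_all
  have neq: "y \<noteq> z" "x \<noteq> y" "x \<noteq> z"
    using ne ab(1) cd(1) xyz[unfolded doubleton_eq_iff] unfolding xyz by blast+
  have s: "hyp x y \<inter> hyp x z \<subseteq> hyp p q"
    using sub hyp_cong[OF xyz(1)] hyp_cong[OF xyz(2)] by simp
  have B: "\<not> (x \<in> B \<and> y \<in> B)" "\<not> (x \<in> B \<and> z \<in> B)"
    using ab(2) cd(2) xyz by (auto simp: doubleton_eq_iff)
  have "adj y z"
  \<comment> \<open>Two boundary vertices cannot be merged by a map that fixes \<open>B\<close>, but
    they are adjacent in the completed graph.\<close>
  proof (cases "y \<in> B \<and> z \<in> B")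
    case True
    then show ?thesis using neq by (simp add: adj_iff)
  next
    case yz: False
    \<comment> \<open>At most one of \<open>x\<close>, \<open>y\<close>, \<open>z\<close> is a
      boundary vertex, so the three can be merged into one of them with \<open>B\<close>
      fixed.\<close>
    obtain f where f: "\<And>b. b \<in> B \<Longrightarrow> f b = b" "f x = f y" "f x = f z"
      "\<And>v w. f v = f w \<Longrightarrow> v = w \<or> {v, w} \<subseteq> {x, y, z}"
    proof -
      consider "y \<notin> B" "z \<notin> B" | "x \<notin> B" "y \<notin> B" | "x \<notin> B" "z \<notin> B" using B yz by blast
      then show thesis
      proof cases
        case 1 then show ?thesis
          using neq by (intro that[of "\<lambda>v. if v = y \<or> v = z then x else v"]) (auto split: if_splits)
      next
        case 2 then show ?thesis
          using neq by (intro that[of "\<lambda>v. if v = x \<or> v = y then z else v"]) (auto split: if_splits)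
      next
        case 3 then show ?thesis
          using neq by (intro that[of "\<lambda>v. if v = x \<or> v = z then y else v"]) (auto split: if_splits)
      qed
    qed
    have "f p = f q" by (rule ends_merged[OF s, of f]) (use f(1-3) in auto)
    then have "{p, q} \<subseteq> {x, y, z}" using f(4) adj_neq[OF pq(1)] by blast
    then have "{p, q} = {y, z}"
      using adj_neq[OF pq(1)] pq(2,3) xyz by auto
    then show ?thesis using pq(1) adj_sym by (auto simp: doubleton_eq_iff)
  qed
  then show thesis using that xyz neq by blast
qed

text \<open>All boundary values vanish on \<open>x\<^sub>0 = 0\<close>, so the test map collapses
  \<open>B\<close> and also merges \<open>c\<close> with \<open>d\<close>. If both are interior, no
  further edge with an interior end is identified; if one is a boundary vertex, it can be exchanged
  for another.\<close>

lemma third_hyperplane_at_infinity: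
  assumes "b \<in> B" "b' \<in> B" and cd: "c \<noteq> d" "\<not> (c \<in> B \<and> d \<in> B)"
    and pq: "adj p q" "\<not> (p \<in> B \<and> q \<in> B)" "{p, q} \<noteq> {c, d}"
    and sub: "hyp b b' \<inter> hyp c d \<subseteq> hyp p q"
  obtains a e e' where "{c, d} = {a, e}" "{p, q} = {a, e'}" "a \<notin> B" "e \<in> B" "e' \<in> B" "e \<noteq> e'"
proof (cases "c \<notin> B \<and> d \<notin> B")
  case True
  define f where "f v = (if v \<in> B then b else if v = c then d else v)" for v
  have "f p = f q"
    by (rule ends_merged_at_infinity[OF sub, of f b]) (use assms True in \<open>auto simp: f_def\<close>)
  then have False
    using adj_neq[OF pq(1)] pq True \<open>b \<in> B\<close> by (auto simp: f_def split: if_splits)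
  then show thesis ..
next
  case False
  moreover obtain a e where "{c, d} = {a, e}" "a \<notin> B" using interior_end[OF cd(2)] .
  ultimately have ae: "{c, d} = {a, e}" "a \<notin> B" "e \<in> B" by (auto simp: doubleton_eq_iff)
  have s: "hyp b b' \<inter> hyp a e \<subseteq> hyp p q" using sub hyp_cong[OF ae(1)] by simp
  define f where "f v = (if v \<in> B \<or> v = a then b else v)" for v
  have "f p = f q"
    by (rule ends_merged_at_infinity[OF s, of f b]) (use assms ae in \<open>auto simp: f_def\<close>)
  then have "p = a \<and> q \<in> B \<or> q = a \<and> p \<in> B"
    using adj_neq[OF pq(1)] pq(2) \<open>b \<in> B\<close> by (auto simp: f_def split: if_splits)
  then obtain e' where "{p, q} = {a, e'}" "e' \<in> B" by (metis insert_commute)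
  then show thesis using that ae pq(3) by metis
qed

end

subsection \<open>Holes and modular chains\<close>

text \<open>Starting at \<open>Suc i\<close>, the cycle returns to \<open>i\<close> after
  \<open>n - 1\<close> steps without using the equation at \<open>i\<close>.\<close>

lemma cycle_transfer:
  assumes "i < n" "\<And>l. \<lbrakk>l < n; l \<noteq> i\<rbrakk> \<Longrightarrow> F l = F (Suc l mod n)"
  shows "F i = F (Suc i mod n)"
proof -
  have "F ((Suc i + m) mod n) = F (Suc i mod n)" if "m < n" for m
    using that
  proof (induction m)
    case (Suc m)
    have "(Suc i + m) mod n \<noteq> i"
    proof (cases "Suc i + m < n")
      case False
      then have "(Suc i + m) mod n = Suc i + m - n"
        using assms(1) Suc.prems by (simp add: le_mod_geq)
      then show ?thesis using False Suc.prems by linarith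
    qed simp
    then have "F ((Suc i + m) mod n) = F (Suc ((Suc i + m) mod n) mod n)"
      using assms by simp
    then show ?case using Suc by (simp add: mod_Suc_eq)
  qed simp
  from this[of "n - 1"] show ?thesis using assms(1) by simp
qed

context
  fixes adj :: "'a \<Rightarrow> 'a \<Rightarrow> bool" and cs :: "'a list"
  assumes hole: "hole adj cs"
begin

abbreviation "nx k \<equiv> Suc k mod length cs"

lemma hole_length: "4 \<le> length cs"
  using hole by (simp add: hole_def)

lemma hole_nth_eq_iff: "k < length cs \<Longrightarrow> l < length cs \<Longrightarrow> cs ! k = cs ! l \<longleftrightarrow> k = l"
  using hole by (simp add: hole_def nth_eq_iff_index_eq)

lemma hole_adj_iff:
  "k < length cs \<Longrightarrow> l < length cs \<Longrightarrow> adj (cs ! k) (cs ! l) \<longleftrightarrow> l = nx k \<or> k = nx l"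
  using hole by (simp add: hole_def)

lemma nx: "k < length cs \<Longrightarrow> nx k = (if k = length cs - 1 then 0 else Suc k)"
  by (auto simp: mod_if)

lemma nx_less: "nx k < length cs"
  using hole_length by (intro mod_less_divisor) linarith

lemma nx_inj: "k < length cs \<Longrightarrow> l < length cs \<Longrightarrow> nx k = nx l \<Longrightarrow> k = l"
  by (auto simp: nx split: if_splits)

lemma nx_no_short_cycle:
  assumes "k < length cs"
  shows "nx k \<noteq> k" "nx (nx k) \<noteq> k" "nx (nx (nx k)) \<noteq> k"
proof -
  have "nx l = (if l = length cs - 1 then 0 else Suc l)" if "l < length cs" for l
    using that by (rule nx)
  note * = this[OF assms] this[OF nx_less[of k]] this[OF nx_less[of "nx k"]]
  have n: "k < length cs" "4 \<le> length cs" using assms hole_length by auto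
  show "nx k \<noteq> k" using n unfolding *(1) by (simp split: if_split)
  show "nx (nx k) \<noteq> k" using n unfolding *(2) unfolding *(1) by (simp split: if_split) linarith
  show "nx (nx (nx k)) \<noteq> k"
    using n unfolding *(3) unfolding *(2) unfolding *(1) by (simp split: if_split) linarith
qed

lemma hole_edges_distinct:
  assumes "k < length cs" "l < length cs" "{cs ! k, cs ! nx k} = {cs ! l, cs ! nx l}"
  shows "k = l"
proof (rule ccontr)
  assume "k \<noteq> l"
  then have "cs ! k = cs ! nx l" "cs ! nx k = cs ! l"
    using assms hole_nth_eq_iff[of k l] by (auto simp: doubleton_eq_iff)
  then have "k = nx l" "nx k = l"
    using assms(1,2) nx_less hole_nth_eq_iff by blast+
  then show False using nx_no_short_cycle(2)[OF assms(1)] by simp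
qed

text \<open>Two edges of a hole with a common vertex have other ends at distance two on the cycle.\<close>
lemma hole_chordless:
  assumes k: "k < length cs" and l: "l < length cs" and "k \<noteq> l"
    and e: "{cs ! k, cs ! nx k} = {x, y}" "{cs ! l, cs ! nx l} = {x, z}"
  shows "\<not> adj y z" "\<not> adj z y"
proof -
  have *: "\<not> adj (cs ! k) (cs ! nx (nx k)) \<and> \<not> adj (cs ! nx (nx k)) (cs ! k)" if "k < length cs" for k
    using hole_adj_iff[OF that nx_less[of "nx k"]] hole_adj_iff[OF nx_less[of "nx k"] that]
      nx_no_short_cycle[OF that] nx_no_short_cycle[OF nx_less[of k]] nx_inj[OF that nx_less]
    by metis
  have x: "x \<in> {cs ! k, cs ! nx k}" "x \<in> {cs ! l, cs ! nx l}" using e by auto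
  then have "k = nx l \<or> l = nx k \<or> nx k = nx l"
    using k l \<open>k \<noteq> l\<close> nx_less hole_nth_eq_iff by blast
  then have "k = nx l \<or> l = nx k" using nx_inj k l \<open>k \<noteq> l\<close> by blast
  then show "\<not> adj y z" "\<not> adj z y"
  proof (atomize (full), elim disjE)
    assume n: "l = nx k"
    have neq: "cs ! k \<noteq> cs ! nx k" "cs ! k \<noteq> cs ! nx (nx k)" "cs ! nx k \<noteq> cs ! nx (nx k)"
      using nx_no_short_cycle[OF k] nx_no_short_cycle[OF l] k l nx_less hole_nth_eq_iff n by metis+
    then have "x = cs ! nx k" using x n by auto
    then have "y = cs ! k" "z = cs ! nx (nx k)" using e n neq by (auto simp: doubleton_eq_iff)
    then show "\<not> adj y z \<and> \<not> adj z y" using *[OF k] by simp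
  next
    assume n: "k = nx l"
    have neq: "cs ! l \<noteq> cs ! nx l" "cs ! l \<noteq> cs ! nx (nx l)" "cs ! nx l \<noteq> cs ! nx (nx l)"
      using nx_no_short_cycle[OF k] nx_no_short_cycle[OF l] k l nx_less hole_nth_eq_iff n by metis+
    then have "x = cs ! nx l" using x n by auto
    then have "z = cs ! l" "y = cs ! nx (nx l)" using e n neq by (auto simp: doubleton_eq_iff)
    then show "\<not> adj y z \<and> \<not> adj z y" using *[OF l] by simp
  qed
qed

text \<open>Otherwise \<open>k\<close>, \<open>nx k\<close> and \<open>m\<close> would form a closed
  cycle of length three.\<close>

lemma hole_no_triangle:
  assumes "k < length cs" "m < length cs" "adj (cs ! m) (cs ! k)" "adj (cs ! m) (cs ! nx k)"
  shows "m = k \<or> m = nx k"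
proof (rule ccontr)
  assume ne: "\<not> (m = k \<or> m = nx k)"
  have "k = nx m" using hole_adj_iff[OF assms(2,1)] assms(3) ne by blast
  moreover have "nx k = nx m \<or> m = nx (nx k)"
    using hole_adj_iff[OF assms(2) nx_less] assms(4) by blast
  ultimately show False
    using ne nx_inj[OF assms(1,2)] nx_no_short_cycle(3)[OF assms(1)] by metis
qed

end

context dirichlet
begin

lemma no_hole_if_modular_maxchain:
  assumes max: "pred_on.maxchain (carrier L) (lless L) C"
    and modular: "\<forall>Y\<in>C. modular_element L (codim W) Y"
  shows "\<not> hole adj cs"
proof
  assume hole: "hole adj cs"
  let ?n = "length cs"
  define s where "s k = Suc k mod ?n" for k
  define H where "H k = hyp (cs ! k) (cs ! s k)" for k
  note hole_facts = hole_length[OF hole] nx_less[OF hole, folded s_def]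
  have n: "4 \<le> ?n" and s_less: "s k < ?n" for k by (rule hole_facts)+
  have edge: "adj (cs ! k) (cs ! s k)" if "k < ?n" for k
    using hole_adj_iff[OF hole that s_less] by (simp add: s_def)
  have chordless: "\<not> adj y z" "\<not> adj z y"
    if "k < ?n" "l < ?n" "k \<noteq> l" "{cs ! k, cs ! s k} = {x, y}" "{cs ! l, cs ! s l} = {x, z}"
    for k l x y z
    using hole_chordless[OF hole that(1-3)] that(4,5) unfolding s_def by blast+
  have distinct: "{cs ! k, cs ! s k} \<noteq> {cs ! l, cs ! s l}" if "k < ?n" "l < ?n" "k \<noteq> l" for k l
    using hole_edges_distinct[OF hole that(1,2)] that(3) unfolding s_def by blast
  \<comment> \<open>\<open>B\<close> is a clique, so a third boundary vertex would give a triangle;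
    hence at most one edge of the hole lies inside \<open>B\<close>.\<close>
  have boundary: "m = k \<or> m = s k"
    if "k < ?n" "m < ?n" "cs ! k \<in> B" "cs ! s k \<in> B" "cs ! m \<in> B" for k m
  proof (rule ccontr)
    assume ne: "\<not> (m = k \<or> m = s k)"
    then have "cs ! m \<noteq> cs ! k" "cs ! m \<noteq> cs ! s k"
      using hole_nth_eq_iff[OF hole] that s_less by auto
    then have "adj (cs ! m) (cs ! k)" "adj (cs ! m) (cs ! s k)"
      using that by (simp_all add: adj_iff)
    then show False
      using hole_no_triangle[OF hole that(1,2)] ne unfolding s_def by blast
  qed
  have inner: "\<not> (cs ! l \<in> B \<and> cs ! s l \<in> B)"
    if "k < ?n" "l < ?n" "k \<noteq> l" "cs ! k \<in> B" "cs ! s k \<in> B" for k l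
  proof
    assume "cs ! l \<in> B \<and> cs ! s l \<in> B"
    then have "l = s k" "s l = k \<or> s l = s k"
      using boundary[of k l] boundary[of k "s l"] that s_less by auto
    then show False
      using nx_inj[OF hole that(1,2)] nx_no_short_cycle(2)[OF hole that(1)] that(3)
      unfolding s_def by metis
  qed
  have "H ` {..<?n} \<subseteq> arr" using edge unfolding H_def arr_def by blast
  moreover have "cs \<noteq> []" using n by auto
  then have "H ` {..<?n} \<noteq> {}" by (simp add: lessThan_empty_iff)
  ultimately obtain Y where Y: "Y \<subseteq> W" "\<exists>h\<in>H ` {..<?n}. \<not> Y \<subseteq> h"
    and step: "\<And>h h'. \<lbrakk>h \<in> H ` {..<?n}; h' \<in> H ` {..<?n}; h \<noteq> h'; \<not> Y \<subseteq> h; \<not> Y \<subseteq> h'\<rbrakk>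
      \<Longrightarrow> \<exists>K\<in>arr. Y \<subseteq> K \<and> h \<inter> h' \<subseteq> K"
    using modular_chain_step[OF max modular, of "H ` {..<?n}"] by blast
  \<comment> \<open>An interior end on edge \<open>l\<close> ensures
    \<open>H k \<noteq> H l\<close>, since all edges inside \<open>B\<close> share a hyperplane. The
    third hyperplane contains \<open>Y\<close>, so it differs from both.\<close>
  have third: "\<exists>p q. adj p q \<and> Y \<subseteq> hyp p q \<and> H k \<inter> H l \<subseteq> hyp p q \<and>
      {p, q} \<noteq> {cs ! k, cs ! s k} \<and> {p, q} \<noteq> {cs ! l, cs ! s l}"
    if kl: "k < ?n" "l < ?n" "\<not> Y \<subseteq> H k" "\<not> Y \<subseteq> H l" "k \<noteq> l" "\<not> (cs ! l \<in> B \<and> cs ! s l \<in> B)"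
    for k l
  proof -
    have "H k \<noteq> H l"
      using hyp_subset_imp_eq[of "cs ! l" "cs ! s l" "cs ! k" "cs ! s k"] kl
        distinct[OF kl(2,1)] adj_neq[OF edge[OF kl(1)]] unfolding H_def by blast
    then obtain K where "K \<in> arr" "Y \<subseteq> K" "H k \<inter> H l \<subseteq> K"
      using step[of "H k" "H l"] kl by blast
    then obtain p q where "adj p q" "Y \<subseteq> hyp p q" "H k \<inter> H l \<subseteq> hyp p q"
      unfolding arr_def by blast
    moreover from this have "{p, q} \<noteq> {cs ! k, cs ! s k}" "{p, q} \<noteq> {cs ! l, cs ! s l}"
      using kl(3,4) hyp_cong unfolding H_def by metis+
    ultimately show ?thesis by blast
  qed
  \<comment> \<open>For two such edges the third hyperplane would come from a chord.\<close>
  have inner_unique: "k = l"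
    if kl: "k < ?n" "l < ?n" "\<not> Y \<subseteq> H k" "\<not> Y \<subseteq> H l" "\<not> (cs ! k \<in> B \<and> cs ! s k \<in> B)"
      "\<not> (cs ! l \<in> B \<and> cs ! s l \<in> B)" for k l
  proof (rule ccontr)
    assume ne: "k \<noteq> l"
    obtain p q where pq: "adj p q" "H k \<inter> H l \<subseteq> hyp p q"
      "{p, q} \<noteq> {cs ! k, cs ! s k}" "{p, q} \<noteq> {cs ! l, cs ! s l}"
      using third[OF kl(1-4) ne kl(6)] by blast
    obtain x y z where "{cs ! k, cs ! s k} = {x, y}" "{cs ! l, cs ! s l} = {x, z}" "adj y z"
      using third_hyperplane[OF adj_neq[OF edge[OF kl(1)]] kl(5) adj_neq[OF edge[OF kl(2)]] kl(6)
          distinct[OF kl(1,2) ne] pq(1,3,4) pq(2)[unfolded H_def]] by metis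
    then show False using chordless[OF kl(1,2) ne] by blast
  qed
  have cycle: "\<psi> (cs ! i) = \<psi> (cs ! s i)"
    if "i < ?n" "\<And>l. l < ?n \<Longrightarrow> l \<noteq> i \<Longrightarrow> \<psi> (cs ! l) = \<psi> (cs ! s l)" for i and \<psi> :: "'v \<Rightarrow> real"
    using cycle_transfer[of i ?n "\<lambda>k. \<psi> (cs ! k)"] that unfolding s_def by blast
  have another: "\<exists>l<?n. l \<noteq> k \<and> \<not> Y \<subseteq> H l" if k: "k < ?n" "\<not> Y \<subseteq> H k" for k
  proof (rule ccontr)
    assume none: "\<not> ?thesis"
    have "p \<in> H k" if "p \<in> Y" for p
    proof -
      have "\<phi> (cs ! k) p = \<phi> (cs ! s k) p"
      proof (rule cycle[of k "\<lambda>v. \<phi> v p"])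
        show "\<phi> (cs ! l) p = \<phi> (cs ! s l) p" if "l < ?n" "l \<noteq> k" for l
          using none that \<open>p \<in> Y\<close> unfolding H_def hyp_def by blast
      qed (rule k)
      then show ?thesis using that Y(1) by (auto simp: H_def hyp_def)
    qed
    then show False using k(2) by blast
  qed
  obtain k where k: "k < ?n" "\<not> Y \<subseteq> H k" using Y(2) by blast
  obtain l where l: "l < ?n" "l \<noteq> k" "\<not> Y \<subseteq> H l" using another[OF k] by blast
  \<comment> \<open>At least two equations fail, and at most one of them belongs to an edge with an
    interior end; so one failing edge \<open>i\<close> lies inside \<open>B\<close>.\<close>
  obtain i j where i: "i < ?n" "\<not> Y \<subseteq> H i" "cs ! i \<in> B" "cs ! s i \<in> B"
    and j: "j < ?n" "i \<noteq> j" "\<not> Y \<subseteq> H j"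
    using inner_unique[OF k(1) l(1) k(2) l(3)] k l by metis
  have j': "\<not> (cs ! j \<in> B \<and> cs ! s j \<in> B)" using inner[OF i(1) j(1,2) i(3,4)] .
  obtain p q where pq: "adj p q" "Y \<subseteq> hyp p q" "H i \<inter> H j \<subseteq> hyp p q"
    "{p, q} \<noteq> {cs ! i, cs ! s i}" "{p, q} \<noteq> {cs ! j, cs ! s j}"
    using third[OF i(1) j(1) i(2) j(3,2) j'] by blast
  have H_i: "H i = {p \<in> W. fst p = 0}"
    unfolding H_def using i adj_neq[OF edge] by (intro hyp_boundary) auto
  have "\<not> (p \<in> B \<and> q \<in> B)"
    using pq(1,2) i(2) adj_neq[of p q] hyp_boundary[of p q] H_i by auto
  then obtain a e e' where aee: "{cs ! j, cs ! s j} = {a, e}" "{p, q} = {a, e'}"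
    "a \<notin> B" "e \<in> B" "e' \<in> B" "e \<noteq> e'"
    using third_hyperplane_at_infinity[OF i(3,4) adj_neq[OF edge[OF j(1)]] j' pq(1) _ pq(5)
        pq(3)[unfolded H_def]] by metis
  obtain m where m: "m < ?n" "cs ! m = e" "m = j \<or> m = s j"
    using aee(1) j(1) s_less by (auto simp: doubleton_eq_iff)
  \<comment> \<open>The boundary end \<open>e\<close> of edge \<open>j\<close> is a boundary vertex
    of the hole, hence an end of edge \<open>i\<close>, so both edges meet in
    \<open>e\<close>.\<close>
  have m': "m = i \<or> m = s i" using boundary[OF i(1) m(1) i(3,4)] m(2) aee(4) by simp
  then obtain e2 where e2: "{cs ! i, cs ! s i} = {e, e2}" using m(2) by auto
  have e2B: "e2 \<in> B" using e2 i(3,4) by (auto simp: doubleton_eq_iff)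
  have "\<not> adj e2 a"
    using chordless(1)[OF i(1) j(1,2) e2] aee(1) by (simp add: insert_commute)
  moreover have "adj e' a" using pq(1) aee(2) adj_sym by (auto simp: doubleton_eq_iff)
  ultimately have "e' \<noteq> e2" by blast
  \<comment> \<open>replacing \<open>e\<close> by \<open>e'\<close> on the cycle, all its equations but \<open>H i\<close> hold on \<open>Y\<close>, hence so does
    \<open>u e' * x\<^sub>0 = u e2 * x\<^sub>0\<close>\<close>
  have Y0: "p \<in> H i" if p: "p \<in> Y" for p
  proof -
    define \<psi> where "\<psi> v = \<phi> (if v = e then e' else v) p" for v
    have "\<psi> (cs ! i) = \<psi> (cs ! s i)"
    proof (rule cycle[OF i(1)])
      fix l assume l: "l < ?n" "l \<noteq> i"
      show "\<psi> (cs ! l) = \<psi> (cs ! s l)"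
      proof (cases "l = j")
        case True
        \<comment> \<open>Under the replacement edge \<open>j\<close> becomes the pair
          \<open>a\<close>, \<open>e'\<close>, whose equation holds on \<open>Y\<close>.\<close>
        have "p \<in> hyp a e'" using pq(2) p hyp_cong[OF aee(2)] by blast
        then have "\<psi> a = \<psi> e" using aee(3,4) by (auto simp: \<psi>_def hyp_def)
        then show ?thesis using True aee(1) by (auto simp: doubleton_eq_iff)
      next
        case False
        have "Y \<subseteq> H l"
        proof (rule ccontr)
          assume "\<not> Y \<subseteq> H l"
          then show False
            using inner_unique[OF l(1) j(1) _ j(3) inner[OF i(1) l(1) l(2)[symmetric] i(3,4)] j'] False
            by blast
        qed
        \<comment> \<open>Only the edges \<open>i\<close> and \<open>j\<close> meet
          \<open>e\<close>, so the other equations are unchanged.\<close>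
        moreover have "l \<noteq> m" "s l \<noteq> m"
          using m(3) m' l False j(2) nx_inj[OF hole, folded s_def] i(1) j(1) by metis+
        then have "cs ! l \<noteq> e" "cs ! s l \<noteq> e"
          using hole_nth_eq_iff[OF hole] l(1) m(1,2) s_less by metis+
        ultimately show ?thesis using p by (auto simp: \<psi>_def H_def hyp_def)
      qed
    qed
    then have "\<phi> e' p = \<phi> e2 p"
      using e2 adj_neq[OF edge[OF i(1)]] by (auto simp: \<psi>_def doubleton_eq_iff split: if_splits)
    then have "p \<in> hyp e' e2" using p Y(1) by (auto simp: hyp_def)
    then show ?thesis using hyp_boundary[OF aee(5) e2B \<open>e' \<noteq> e2\<close>] H_i by simp
  qed
  then show False using i(2) by blast
qed

section \<open>The equivalence\<close>

lemma symp_adj: "symp adj"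
  using adj_sym by (rule sympI)

lemma irreflp_adj: "irreflp adj"
  using adj_neq by (auto intro: irreflpI)

lemma adj_eq: "adj = (\<lambda>v w. {v, w} \<in> add_clique E B)"
  by (intro ext) (rule adj_def)

lemma simple_add_clique: "simple_graph (add_clique E B)"
  using simple by (auto simp: simple_graph_def add_clique_def)

lemma modular_W: "modular_element L (codim W) W"
proof -
  have "{y + z | y z. y \<in> W \<and> z \<in> Z} = W" if "Z \<in> carrier L" for Z
  proof
    show "{y + z | y z. y \<in> W \<and> z \<in> Z} \<subseteq> W"
      using flat_subset[OF that] subspace_add[OF subspace_W] by blast
    show "W \<subseteq> {y + z | y z. y \<in> W \<and> z \<in> Z}"
      by (rule subset_sums(1)) (rule subspace_0[OF subspace_flat[OF that]])
  qed
  then show ?thesis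
    unfolding modular_element_iff_sums[OF flat_W] using flat_W by simp
qed

lemma supersolvable_iff_chordal:
  "supersolvable (- B) (dirichlet_space B u) (dirichlet_arrangement E B u) \<longleftrightarrow>
    chordal (add_clique E B)"
proof
  assume "supersolvable (- B) (dirichlet_space B u) (dirichlet_arrangement E B u)"
  then obtain C where "pred_on.maxchain (carrier L) (lless L) C"
    "\<forall>Y\<in>C. modular_element L (codim W) Y"
    unfolding supersolvable_def cone_dirichlet_arrangement Let_def by blast
  then have "\<nexists>cs. hole adj cs" using no_hole_if_modular_maxchain by blast
  then obtain vs where "set vs = UNIV" "elimination_list adj {} vs"
    using elimination_list_if_no_hole[OF symp_adj irreflp_adj, of UNIV "{}"] by auto
  then show "chordal (add_clique E B)"
    using perfect_elimination_ordering_if_elimination_list simple_add_clique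
    unfolding chordal_def adj_eq by blast
next
  assume "chordal (add_clique E B)"
  then have "\<nexists>cs. hole adj cs"
    using no_hole_if_perfect_elimination_ordering unfolding chordal_def adj_eq by blast
  \<comment> \<open>With \<open>K = B\<close> the boundary is kept to the end, and \<open>vs\<close>
    orders the interior vertices only.\<close>
  moreover have "pairwise adj B" by (auto simp: pairwise_def adj_iff)
  ultimately obtain vs where vs: "set vs = - B" "elimination_list adj B vs"
    using elimination_list_if_no_hole[OF symp_adj irreflp_adj, of UNIV B]
    by (auto simp: Compl_eq_Diff_UNIV)
  show "supersolvable (- B) (dirichlet_space B u) (dirichlet_arrangement E B u)"
    unfolding supersolvable_def cone_dirichlet_arrangement Let_def
  proof (intro exI conjI ballI)
    show "pred_on.maxchain (carrier L) (lless L)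
        (insert W ((\<lambda>s. vanishing (set (drop s vs))) ` {..length vs}))"
      by (rule maxchain_vanishing[OF vs(2,1)])
    fix Y assume "Y \<in> insert W ((\<lambda>s. vanishing (set (drop s vs))) ` {..length vs})"
    then consider "Y = W" | s where "Y = vanishing (set (drop s vs))" by blast
    then show "modular_element L (codim W) Y"
      using modular_W modular_vanishing[OF vs(2,1)] by cases simp_all
  qed
qed

end

theorem theorem1p2:
  fixes E :: "'v::finite set set"
    and B :: "'v set"
    and u :: "'v \<Rightarrow> real"
  assumes "simple_graph E"
    and "graph_connected E"
    and "B \<subset> UNIV"
    and "card B \<ge> 2"
    and "\<forall>i\<in>B. \<forall>j\<in>B. {i, j} \<notin> E"
    and "inj_on u B"
  shows "supersolvable (- B) (dirichlet_space B u) (dirichlet_arrangement E B u) \<longleftrightarrow>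
    chordal (add_clique E B)"
proof -
  interpret dirichlet E B u
    using assms by unfold_locales
  show ?thesis by (rule supersolvable_iff_chordal)
qed

end
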